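(* Let $X=\mathcal M(\Omega)$ and $C=L^\infty(\Omega,[-1,1])\subset\mathcal M(\Omega)$, and consider the problem "minimize $J(x)$ subject to $x\in C$". Assume that $\bar x\in C$ is fixed, that $J$ satisfies the second-order expansion assumption at $\bar x$ stated in the context, that the map $X\ni h\mapsto J''(\bar x)h^2\in\mathbb R$ is weak-$\star$ continuous, that $\bar\varphi:=J'(\bar x)\in-\mathcal N_C^\star(\bar x)$, and that the constant $$K(\bar\varphi):=\frac14\liminf_{s\searrow0}\left(\frac{s}{\mathcal L^d(\{|\bar\varphi|\le s\})}\right)\in[0,+\infty]$$ is positive. Then the condition $$Q_C^{\bar x,\bar\varphi}(h)+J''(\bar x)h^2>0\qquad\forall h\in\mathcal K_C^\star(\bar x,\bar\varphi)\setminus\{0\}$$ is equivalent to the existence of constants $c>0$ and $\varepsilon>0$ such that $$J(x)\ge J(\bar x)+\frac c2\|x-\bar x\|_{L^1(\Omega)}^2\qquad\forall x\in C\cap B_\varepsilon^X(\bar x).$$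
   Context: Setting: $\Omega\subset\mathbb R^d$, $d\ge1$, is a bounded domain with Lipschitz boundary; $\mathcal L^d$ is Lebesgue measure. $Y:=C_0(\Omega)$ is the closure of $C_c(\Omega)$ in the supremum norm, and its dual is identified with $X:=\mathcal M(\Omega)$, the space of signed finite Radon measures on $\Omega$ with norm $\|\mu\|_{\mathcal M(\Omega)}=|\mu|(\Omega)$. $L^1(\Omega)$ is identified with a closed subspace of $\mathcal M(\Omega)$ via the isometric embedding $x\mapsto x\mathcal L^d$. $C:=L^\infty(\Omega,[-1,1])=\{x\in L^\infty(\Omega):-1\le x\le1\text{ a.e. in }\Omega\}\subset\mathcal M(\Omega)$. $\iota:Y\to X^\star$ is the canonical embedding; elements of $\iota(Y)$ are identified with functions in $C_0(\Omega)$. $B_\varepsilon^X(\bar x)$ is the closed ball of radius $\varepsilon$ around $\bar x$ in $X$. Second-order expansion assumption at $\bar x$: $J:C\to\mathbb R$ is such that there exist $J'(\bar x)\in\iota(Y)$ and a bounded bilinear form $J''(\bar x):X\times X\to\mathbb R$ with $$\lim_{k\to\infty}\frac{J(\bar x+t_kh_k)-J(\bar x)-t_kJ'(\bar x)h_k-\frac12t_k^2J''(\bar x)h_k^2}{t_k^2}=0$$ for all $\{h_k\}\subset X$, $\{t_k\}\subset\mathbb R^+$ with $t_k\searrow0$, $h_k\stackrel{\star}{\rightharpoonup}h\in X$ (weak-$\star$ convergence) and $\bar x+t_kh_k\in C$. Here $J'(\bar x)h:=\langle J'(\bar x),h\rangle$ and $J''(\bar x)h^2:=J''(\bar x)(h,h)$.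 For $x\in C$: $\mathcal T_C^\star(x):=\{h\in X\mid\exists t_k\searrow0,\ \exists x_k\in C:\ (x_k-x)/t_k\stackrel{\star}{\rightharpoonup}h\}$; $\mathcal N_C^\star(x):=\{x^\star\in\iota(Y)\mid\langle x^\star,h\rangle\le0\ \forall h\in\mathcal T_C^\star(x)\}$; for $\varphi\in-\mathcal N_C^\star(x)$, $\mathcal K_C^\star(x,\varphi):=\mathcal T_C^\star(x)\cap\varphi^\perp$, where $\varphi^\perp=\{h\in X\mid\langle\varphi,h\rangle=0\}$. The directional curvature functional $Q_C^{x,\varphi}:\mathcal K_C^\star(x,\varphi)\to[-\infty,\infty]$ is $$Q_C^{x,\varphi}(h):=\inf\Big\{\liminf_{k\to\infty}\langle\varphi,r_k\rangle\ \Big|\ \{r_k\}\subset X,\{t_k\}\subset\mathbb R^+:\ t_k\searrow0,\ t_kr_k\stackrel{\star}{\rightharpoonup}0,\ x+t_kh+\tfrac12t_k^2r_k\in C\Big\}.$$ *)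

theory Defs
  imports "HOL-Analysis.Analysis"
begin

section \<open>Bounded Lipschitz domains\<close>

text \<open>Near each boundary point, \<open>\<Omega>\<close> is the strict subgraph, in some direction \<open>e\<close>, of a Lipschitz
  function on the hyperplane orthogonal to \<open>e\<close>.\<close>

definition lipschitz_boundary :: "'a::euclidean_space set \<Rightarrow> bool" where
  "lipschitz_boundary \<Omega> \<longleftrightarrow>
    (\<forall>p\<in>frontier \<Omega>. \<exists>e r L \<gamma>. norm e = 1 \<and> r > 0 \<and>
       L-lipschitz_on {z. z \<bullet> e = 0} \<gamma> \<and>
       \<Omega> \<inter> ball p r = {y \<in> ball p r. y \<bullet> e < \<gamma> (y - (y \<bullet> e) *\<^sub>R e)})"

definition bounded_lipschitz_domain :: "'a::euclidean_space set \<Rightarrow> bool" where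
  "bounded_lipschitz_domain \<Omega> \<longleftrightarrow>
    open \<Omega> \<and> connected \<Omega> \<and> \<Omega> \<noteq> {} \<and> bounded \<Omega> \<and> lipschitz_boundary \<Omega>"

section \<open>Signed finite Radon measures\<close>

text \<open>A signed measure on \<open>\<Omega>\<close> is a real-valued set function on the Borel subsets of \<open>\<Omega>\<close>, set to
  \<open>0\<close> on all other sets, so that equality of measures is equality of functions and the vector
  space operations are pointwise.\<close>

abbreviation borel_sets :: "'a::euclidean_space set \<Rightarrow> 'a set set" where
  "borel_sets \<Omega> \<equiv> sets (restrict_space borel \<Omega>)"

definition signed_measures :: "'a::euclidean_space set \<Rightarrow> ('a set \<Rightarrow> real) set" where
  "signed_measures \<Omega> = {\<mu>.
     (\<forall>A. A \<notin> borel_sets \<Omega> \<longrightarrow> \<mu> A = 0) \<and> \<mu> {} = 0 \<and>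
     (\<forall>A :: nat \<Rightarrow> 'a set. range A \<subseteq> borel_sets \<Omega> \<and> disjoint_family A \<longrightarrow>
        (\<lambda>n. \<mu> (A n)) sums \<mu> (\<Union>n. A n))}"

text \<open>The positive part of the Jordan decomposition, \<open>\<mu>\<^sup>+(A) = sup {\<mu>(B) | B \<subseteq> A Borel}\<close>, and the
  negative part, which is the positive part of \<open>-\<mu>\<close>.\<close>

definition pos_part :: "'a::euclidean_space set \<Rightarrow> ('a set \<Rightarrow> real) \<Rightarrow> 'a measure" where
  "pos_part \<Omega> \<mu> = measure_of \<Omega> (borel_sets \<Omega>)
     (\<lambda>A. SUP B\<in>{B \<in> borel_sets \<Omega>. B \<subseteq> A}. ennreal (\<mu> B))"

definition neg_part :: "'a::euclidean_space set \<Rightarrow> ('a set \<Rightarrow> real) \<Rightarrow> 'a measure" where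
  "neg_part \<Omega> \<mu> = pos_part \<Omega> (\<lambda>A. - \<mu> A)"

definition variation :: "'a::euclidean_space set \<Rightarrow> ('a set \<Rightarrow> real) \<Rightarrow> 'a set \<Rightarrow> real" where
  "variation \<Omega> \<mu> A = measure (pos_part \<Omega> \<mu>) A + measure (neg_part \<Omega> \<mu>) A"

text \<open>Finiteness is built into \<open>signed_measures\<close>. Inner regularity holds for every finite Borel
  measure on an open subset of a Euclidean space and is stated for definiteness.\<close>

definition radon :: "'a::euclidean_space set \<Rightarrow> ('a set \<Rightarrow> real) set" where
  "radon \<Omega> = {\<mu> \<in> signed_measures \<Omega>.
     \<forall>A\<in>borel_sets \<Omega>. \<forall>e>0. \<exists>K. compact K \<and> K \<subseteq> A \<and> variation \<Omega> \<mu> (A - K) < e}"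

definition tv_norm :: "'a::euclidean_space set \<Rightarrow> ('a set \<Rightarrow> real) \<Rightarrow> real" where
  "tv_norm \<Omega> \<mu> = variation \<Omega> \<mu> \<Omega>"

section \<open>The predual, the dual pairing and weak-star convergence\<close>

text \<open>Functions on \<open>\<Omega>\<close> are represented by functions on the whole space whose values outside
  \<open>\<Omega>\<close> play no role.\<close>

definition Cc :: "'a::euclidean_space set \<Rightarrow> ('a \<Rightarrow> real) set" where
  "Cc \<Omega> = {f. continuous_on \<Omega> f \<and> (\<exists>K. compact K \<and> K \<subseteq> \<Omega> \<and> (\<forall>w\<in>\<Omega> - K. f w = 0))}"

definition C0 :: "'a::euclidean_space set \<Rightarrow> ('a \<Rightarrow> real) set" where
  "C0 \<Omega> = {f. \<forall>e>0. \<exists>g\<in>Cc \<Omega>. \<forall>w\<in>\<Omega>. \<bar>f w - g w\<bar> \<le> e}"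

definition pairing :: "'a::euclidean_space set \<Rightarrow> ('a \<Rightarrow> real) \<Rightarrow> ('a set \<Rightarrow> real) \<Rightarrow> real" where
  "pairing \<Omega> f \<mu> = integral\<^sup>L (pos_part \<Omega> \<mu>) f - integral\<^sup>L (neg_part \<Omega> \<mu>) f"

definition weak_star_conv ::
  "'a::euclidean_space set \<Rightarrow> (nat \<Rightarrow> 'a set \<Rightarrow> real) \<Rightarrow> ('a set \<Rightarrow> real) \<Rightarrow> bool" where
  "weak_star_conv \<Omega> h h0 \<longleftrightarrow> (\<forall>k. h k \<in> radon \<Omega>) \<and> h0 \<in> radon \<Omega> \<and>
     (\<forall>f\<in>C0 \<Omega>. (\<lambda>k. pairing \<Omega> f (h k)) \<longlonglongrightarrow> pairing \<Omega> f h0)"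

text \<open>Weak-star continuity on the space of measures is understood sequentially, in line with the
  definitions of the cones and the curvature functional below.\<close>

definition weak_star_continuous ::
  "'a::euclidean_space set \<Rightarrow> (('a set \<Rightarrow> real) \<Rightarrow> real) \<Rightarrow> bool" where
  "weak_star_continuous \<Omega> F \<longleftrightarrow>
     (\<forall>h h0. weak_star_conv \<Omega> h h0 \<longrightarrow> (\<lambda>k. F (h k)) \<longlonglongrightarrow> F h0)"

section \<open>The admissible set\<close>

definition Linf_ball :: "'a::euclidean_space set \<Rightarrow> ('a \<Rightarrow> real) set" where
  "Linf_ball \<Omega> = {x \<in> borel_measurable (lebesgue_on \<Omega>).
     AE w in lebesgue_on \<Omega>. - 1 \<le> x w \<and> x w \<le> 1}"

text \<open>The embedding \<open>x \<mapsto> x \<L>\<^sup>d\<close> of integrable functions into the measures on \<open>\<Omega>\<close>.\<close>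

definition embed_L1 :: "'a::euclidean_space set \<Rightarrow> ('a \<Rightarrow> real) \<Rightarrow> 'a set \<Rightarrow> real" where
  "embed_L1 \<Omega> x = (\<lambda>A. if A \<in> borel_sets \<Omega> then (LINT w:A|lebesgue. x w) else 0)"

definition L1_norm :: "'a::euclidean_space set \<Rightarrow> ('a \<Rightarrow> real) \<Rightarrow> real" where
  "L1_norm \<Omega> x = (LINT w|lebesgue_on \<Omega>. \<bar>x w\<bar>)"

definition Cset :: "'a::euclidean_space set \<Rightarrow> ('a set \<Rightarrow> real) set" where
  "Cset \<Omega> = embed_L1 \<Omega> ` Linf_ball \<Omega>"

section \<open>Second-order expansion\<close>

definition null_seq :: "(nat \<Rightarrow> real) \<Rightarrow> bool" where
  "null_seq t \<longleftrightarrow> (\<forall>k. t k > 0) \<and> t \<longlonglongrightarrow> 0"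

definition bounded_bilinear_form ::
  "'a::euclidean_space set \<Rightarrow> (('a set \<Rightarrow> real) \<Rightarrow> ('a set \<Rightarrow> real) \<Rightarrow> real) \<Rightarrow> bool" where
  "bounded_bilinear_form \<Omega> B \<longleftrightarrow>
     (\<forall>\<mu>\<in>radon \<Omega>. \<forall>\<nu>\<in>radon \<Omega>. \<forall>\<rho>\<in>radon \<Omega>. \<forall>a b.
        B (\<lambda>A. a * \<mu> A + b * \<nu> A) \<rho> = a * B \<mu> \<rho> + b * B \<nu> \<rho> \<and>
        B \<rho> (\<lambda>A. a * \<mu> A + b * \<nu> A) = a * B \<rho> \<mu> + b * B \<rho> \<nu>) \<and>
     (\<exists>M. \<forall>\<mu>\<in>radon \<Omega>. \<forall>\<nu>\<in>radon \<Omega>. \<bar>B \<mu> \<nu>\<bar> \<le> M * tv_norm \<Omega> \<mu> * tv_norm \<Omega> \<nu>)"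

text \<open>\<open>J1\<close> and \<open>J2\<close> are the derivatives \<open>J'(x)\<close>, given by a function in \<open>C\<^sub>0(\<Omega>)\<close>, and \<open>J''(x)\<close>.
  Only the values of \<open>J\<close> on \<open>Cset \<Omega>\<close> matter.\<close>

definition second_order_expansion ::
  "'a::euclidean_space set \<Rightarrow> (('a set \<Rightarrow> real) \<Rightarrow> real) \<Rightarrow> ('a set \<Rightarrow> real) \<Rightarrow> ('a \<Rightarrow> real) \<Rightarrow>
    (('a set \<Rightarrow> real) \<Rightarrow> ('a set \<Rightarrow> real) \<Rightarrow> real) \<Rightarrow> bool" where
  "second_order_expansion \<Omega> J x J1 J2 \<longleftrightarrow>
     J1 \<in> C0 \<Omega> \<and> bounded_bilinear_form \<Omega> J2 \<and>
     (\<forall>h t h0. null_seq t \<and> weak_star_conv \<Omega> h h0 \<and>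
        (\<forall>k. (\<lambda>A. x A + t k * h k A) \<in> Cset \<Omega>) \<longrightarrow>
        (\<lambda>k. (J (\<lambda>A. x A + t k * h k A) - J x - t k * pairing \<Omega> J1 (h k)
               - 1/2 * (t k)^2 * J2 (h k) (h k)) / (t k)^2) \<longlonglongrightarrow> 0)"

section \<open>Tangent, normal and critical cones; directional curvature\<close>

definition tangent_cone ::
  "'a::euclidean_space set \<Rightarrow> ('a set \<Rightarrow> real) \<Rightarrow> ('a set \<Rightarrow> real) set" where
  "tangent_cone \<Omega> x = {h \<in> radon \<Omega>. \<exists>t y. null_seq t \<and> (\<forall>k. y k \<in> Cset \<Omega>) \<and>
     weak_star_conv \<Omega> (\<lambda>k A. (y k A - x A) / t k) h}"

definition normal_cone ::
  "'a::euclidean_space set \<Rightarrow> ('a set \<Rightarrow> real) \<Rightarrow> ('a \<Rightarrow> real) set" where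
  "normal_cone \<Omega> x = {f \<in> C0 \<Omega>. \<forall>h\<in>tangent_cone \<Omega> x. pairing \<Omega> f h \<le> 0}"

definition critical_cone ::
  "'a::euclidean_space set \<Rightarrow> ('a set \<Rightarrow> real) \<Rightarrow> ('a \<Rightarrow> real) \<Rightarrow> ('a set \<Rightarrow> real) set" where
  "critical_cone \<Omega> x \<phi> = tangent_cone \<Omega> x \<inter> {h \<in> radon \<Omega>. pairing \<Omega> \<phi> h = 0}"

definition curvature ::
  "'a::euclidean_space set \<Rightarrow> ('a set \<Rightarrow> real) \<Rightarrow> ('a \<Rightarrow> real) \<Rightarrow> ('a set \<Rightarrow> real) \<Rightarrow> ereal" where
  "curvature \<Omega> x \<phi> h = Inf {liminf (\<lambda>k. ereal (pairing \<Omega> \<phi> (r k))) | r t.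
     (\<forall>k. r k \<in> radon \<Omega>) \<and> null_seq t \<and>
     weak_star_conv \<Omega> (\<lambda>k A. t k * r k A) (\<lambda>A. 0) \<and>
     (\<forall>k. (\<lambda>A. x A + t k * h A + 1/2 * (t k)^2 * r k A) \<in> Cset \<Omega>)}"

text \<open>Computed in \<open>[0, \<infinity>]\<close>, where \<open>s / 0 = \<infinity>\<close> for \<open>s > 0\<close>.\<close>

definition K_const :: "'a::euclidean_space set \<Rightarrow> ('a \<Rightarrow> real) \<Rightarrow> ennreal" where
  "K_const \<Omega> \<phi> =
     1/4 * Liminf (at_right 0) (\<lambda>s::real. ennreal s / emeasure lebesgue {w \<in> \<Omega>. \<bar>\<phi> w\<bar> \<le> s})"

end

theory Submission
  imports Defs "HOL-Probability.Helly_Selection"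
begin

text \<open>
  Write \<open>x\<close> for the reference point and \<open>\<phi>\<close> for the derivative there.

  Growth implies the curvature condition by a direct expansion. If \<open>x + t\<^sub>k h + t\<^sub>k\<^sup>2 r\<^sub>k / 2\<close> is
  feasible, put \<open>g\<^sub>k = h + t\<^sub>k r\<^sub>k / 2\<close>, which converges weak-star to \<open>h\<close>. As \<open>\<langle>\<phi>, h\<rangle> = 0\<close>, dividing the
  second-order expansion of \<open>J\<close> along \<open>g\<^sub>k\<close> by \<open>t\<^sub>k\<^sup>2\<close> turns the growth inequality into a lower bound for
  \<open>\<langle>\<phi>, r\<^sub>k\<rangle> + J'' g\<^sub>k\<^sup>2\<close> by a multiple of \<open>\<parallel>g\<^sub>k\<parallel>\<^sup>2\<close>. Two facts about weak-star convergence enter: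
  \<open>\<parallel>g\<^sub>k\<parallel>\<close> is bounded (\<open>uniform_boundedness_measures\<close>), so that the points stay in the ball on which
  growth is assumed, and \<open>\<parallel>g\<^sub>k\<parallel>\<close> stays away from \<open>0\<close>, because some function in \<open>C\<^sub>0\<close> does not
  annihilate \<open>h\<close> (\<open>C0_separates_measures\<close>).

  For the converse suppose that growth fails along \<open>y\<^sub>k \<rightarrow> x\<close>, and put \<open>t\<^sub>k = \<parallel>y\<^sub>k - x\<parallel>\<close> and
  \<open>g\<^sub>k = (y\<^sub>k - x) / t\<^sub>k\<close>. The \<open>g\<^sub>k\<close> are densities of norm one, hence have a subsequence that converges
  weak-star to a measure \<open>h\<close> (\<open>weak_star_subsequence\<close>), which in general has no density. The
  failure of growth bounds \<open>\<langle>\<phi>, g\<^sub>k\<rangle> / t\<^sub>k\<close> from above by a sequence tending to \<open>- J'' h\<^sup>2 / 2\<close>. Hence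
  \<open>\<langle>\<phi>, h\<rangle> = 0\<close>, the direction \<open>h\<close> is critical, and \<open>r\<^sub>k = 2 (g\<^sub>k - h) / t\<^sub>k\<close> shows that its curvature is
  at most \<open>- J'' h\<^sup>2\<close>. This contradicts the curvature condition as soon as \<open>h \<noteq> 0\<close>. The case \<open>h = 0\<close>
  is excluded by the constant \<open>K\<close>: the normal cone condition forces \<open>x = - sgn \<phi>\<close> wherever
  \<open>\<phi> \<noteq> 0\<close>, so \<open>\<langle>\<phi>, y - x\<rangle> = \<integral>\<bar>\<phi>\<bar> \<bar>y - x\<bar>\<close> (\<open>normal_cone_sign\<close>). A function bounded by \<open>2\<close> cannot
  concentrate its mass on the small sets \<open>{\<bar>\<phi>\<bar> \<le> s}\<close>, so this integral is at least a multiple of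
  \<open>\<parallel>y - x\<parallel>\<^sup>2\<close> (\<open>weighted_L1_quadratic_growth\<close>). Hence \<open>\<langle>\<phi>, g\<^sub>k\<rangle> / t\<^sub>k\<close> is bounded below by a positive
  constant and \<open>J'' h\<^sup>2 < 0\<close>, whereas \<open>J'' 0\<^sup>2 = 0\<close>.

  Most of the work is the measure theory behind this argument. Signed measures are set functions,
  and the pairing is defined by the Jordan decomposition, whose dependence on the measure is not
  linear. Linearity is recovered by writing the pairing as a limit of sums over level sets of the
  integrand, in which the measure enters linearly (\<open>level_sum_pairing\<close>). For weak-star
  compactness, a bounded subset of a Euclidean space is coded into the real line by an injection with continuous left inverse, and there the
  limit measure is supplied by Helly's selection theorem.
\<close>

section \<open>Jordan decomposition of signed measures\<close>

lemma sigma_algebra_borel_sets: "sigma_algebra \<Omega> (borel_sets \<Omega>)"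
  using sets.sigma_algebra_axioms[of "restrict_space borel \<Omega>"] by (simp add: space_restrict_space)

lemma borel_sets_subset: "A \<in> borel_sets \<Omega> \<Longrightarrow> A \<subseteq> \<Omega>"
  using sets.sets_into_space[of A "restrict_space borel \<Omega>"] by (simp add: space_restrict_space)

lemma signed_measures_empty: "\<mu> \<in> signed_measures \<Omega> \<Longrightarrow> \<mu> {} = 0"
  by (simp add: signed_measures_def)

lemma signed_measures_sums:
  fixes A :: "nat \<Rightarrow> 'a::euclidean_space set"
  assumes "\<mu> \<in> signed_measures \<Omega>" "\<And>n. A n \<in> borel_sets \<Omega>" "disjoint_family A"
  shows "(\<lambda>n. \<mu> (A n)) sums \<mu> (\<Union>n. A n)"
  using assms by (auto simp: signed_measures_def)

lemma signed_measures_Un: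
  assumes "\<mu> \<in> signed_measures \<Omega>" "A \<in> borel_sets \<Omega>" "B \<in> borel_sets \<Omega>" "A \<inter> B = {}"
  shows "\<mu> (A \<union> B) = \<mu> A + \<mu> B"
proof -
  have "(\<lambda>n. \<mu> (binaryset A B n)) sums \<mu> (\<Union>n. binaryset A B n)"
    using assms
    by (intro signed_measures_sums) (auto simp: binaryset_def disjoint_family_on_def)
  moreover have "(\<lambda>n. \<mu> (binaryset A B n)) sums (\<mu> A + \<mu> B)"
    by (intro binaryset_sums signed_measures_empty[OF assms(1)])
  ultimately show ?thesis
    by (metis UN_binaryset_eq sums_unique2)
qed

lemma signed_measures_Diff:
  assumes "\<mu> \<in> signed_measures \<Omega>" "A \<in> borel_sets \<Omega>" "B \<in> borel_sets \<Omega>" "B \<subseteq> A"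
  shows "\<mu> (A - B) = \<mu> A - \<mu> B"
proof -
  have "\<mu> (B \<union> (A - B)) = \<mu> B + \<mu> (A - B)"
    using assms by (intro signed_measures_Un) auto
  moreover have "B \<union> (A - B) = A" using assms by auto
  ultimately show ?thesis by simp
qed

lemma signed_measures_linear:
  assumes "\<mu> \<in> signed_measures \<Omega>" "\<nu> \<in> signed_measures \<Omega>"
  shows "(\<lambda>A. a * \<mu> A + b * \<nu> A) \<in> signed_measures \<Omega>"
  using assms unfolding signed_measures_def
  by (auto intro!: sums_add sums_mult)

lemma signed_measures_uminus:
  assumes "\<mu> \<in> signed_measures \<Omega>" shows "(\<lambda>A. - \<mu> A) \<in> signed_measures \<Omega>"
  using signed_measures_linear[OF assms assms, of "-1" 0] by simp

lemma sets_pos_part [simp, measurable_cong]: "sets (pos_part \<Omega> \<mu>) = sets (restrict_space borel \<Omega>)"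
  unfolding pos_part_def
  by (simp add: sigma_algebra.sets_measure_of_eq[OF sigma_algebra_borel_sets])

lemma space_pos_part [simp]: "space (pos_part \<Omega> \<mu>) = \<Omega>"
  using sets_eq_imp_space_eq[OF sets_pos_part[of \<Omega> \<mu>]] by (simp add: space_restrict_space)

lemma sets_neg_part [simp, measurable_cong]: "sets (neg_part \<Omega> \<mu>) = sets (restrict_space borel \<Omega>)"
  by (simp add: neg_part_def)

lemma space_neg_part [simp]: "space (neg_part \<Omega> \<mu>) = \<Omega>"
  by (simp add: neg_part_def)

text \<open>
  The set function \<open>A \<mapsto> sup {\<mu> B | B \<subseteq> A}\<close> is countably additive because a subset \<open>B\<close> of a
  disjoint union splits along the pieces, and subsets of the pieces can be united. Values are
  taken in \<open>[0, \<infinity>]\<close>, so finiteness is a separate matter.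
\<close>

lemma emeasure_pos_part:
  assumes \<mu>: "\<mu> \<in> signed_measures \<Omega>" and A: "A \<in> borel_sets \<Omega>"
  shows "emeasure (pos_part \<Omega> \<mu>) A = (SUP B\<in>{B \<in> borel_sets \<Omega>. B \<subseteq> A}. ennreal (\<mu> B))"
proof -
  define p where "p A = (SUP B\<in>{B \<in> borel_sets \<Omega>. B \<subseteq> A}. ennreal (\<mu> B))" for A
  have p_upper: "ennreal (\<mu> B) \<le> p A" if "B \<in> borel_sets \<Omega>" "B \<subseteq> A" for A B
    unfolding p_def using that by (intro SUP_upper) auto
  have p_mono: "p A \<le> p B" if "A \<subseteq> B" for A B
    unfolding p_def using that by (intro SUP_subset_mono) auto
  \<comment> \<open>Superadditivity yields one inequality for countable unions; the converse follows by splitting subsets.\<close>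
  have super: "p A + p A' \<le> p (A \<union> A')" if "A \<inter> A' = {}" for A A'
  proof -
    let ?S = "\<lambda>A. {B \<in> borel_sets \<Omega>. B \<subseteq> A}"
    have ne: "?S A \<noteq> {}" for A by auto
    have "ennreal (\<mu> B) + ennreal (\<mu> B') \<le> p (A \<union> A')"
      if B: "B \<in> ?S A" "B' \<in> ?S A'" for B B'
    proof (cases "\<mu> B \<ge> 0 \<and> \<mu> B' \<ge> 0")
      case True
      have "ennreal (\<mu> B) + ennreal (\<mu> B') = ennreal (\<mu> (B \<union> B'))"
        using True B \<open>A \<inter> A' = {}\<close> by (subst signed_measures_Un[OF \<mu>]) auto
      also have "\<dots> \<le> p (A \<union> A')" using B by (intro p_upper) auto
      finally show ?thesis .
    next
      case False
      have "ennreal (\<mu> B) \<le> p (A \<union> A')" "ennreal (\<mu> B') \<le> p (A \<union> A')"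
        using B by (auto intro!: p_upper)
      with False show ?thesis by (auto simp: not_le ennreal_neg)
    qed
    then have "(SUP B'\<in>?S A'. SUP B\<in>?S A. ennreal (\<mu> B) + ennreal (\<mu> B')) \<le> p (A \<union> A')"
      by (intro SUP_least)
    then show ?thesis
      unfolding p_def[of A] p_def[of A'] ennreal_SUP_add_left[OF ne, symmetric] ennreal_SUP_add_right[OF ne] .
  qed
  have "countably_additive (borel_sets \<Omega>) p"
  proof (rule countably_additiveI)
    fix A :: "nat \<Rightarrow> 'a set"
    assume A: "range A \<subseteq> borel_sets \<Omega>" "disjoint_family A" "(\<Union>i. A i) \<in> borel_sets \<Omega>"
    have fin: "(\<Sum>i<n. p (A i)) \<le> p (\<Union>i<n. A i)" for n
    proof (induction n)
      case (Suc n)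
      have "(\<Union>i<n. A i) \<inter> A n = {}"
        using disjoint_family_onD[OF A(2)] by (fastforce dest: less_imp_neq)
      then have "p (\<Union>i<n. A i) + p (A n) \<le> p ((\<Union>i<n. A i) \<union> A n)" by (rule super)
      also have "(\<Union>i<n. A i) \<union> A n = (\<Union>i<Suc n. A i)" by (auto simp: less_Suc_eq)
      finally show ?case using Suc by (auto intro: order_trans add_right_mono)
    qed simp
    have "(\<Sum>i. p (A i)) \<le> p (\<Union>i. A i)"
      by (intro suminf_le_const order_trans[OF fin p_mono]) auto
    moreover have "p (\<Union>i. A i) \<le> (\<Sum>i. p (A i))"
      unfolding p_def[of "\<Union>i. A i"]
    proof (rule SUP_least)
      fix B assume B: "B \<in> {B \<in> borel_sets \<Omega>. B \<subseteq> (\<Union>i. A i)}"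
      have "(\<lambda>i. \<mu> (B \<inter> A i)) sums \<mu> (\<Union>i. B \<inter> A i)"
        using A B by (intro signed_measures_sums[OF \<mu>]) (auto simp: disjoint_family_on_def)
      moreover have "(\<Union>i. B \<inter> A i) = B" using B by auto
      ultimately have "(\<lambda>n. \<Sum>i<n. \<mu> (B \<inter> A i)) \<longlonglongrightarrow> \<mu> B" by (simp add: sums_def)
      then have "(\<lambda>n. ennreal (\<Sum>i<n. \<mu> (B \<inter> A i))) \<longlonglongrightarrow> ennreal (\<mu> B)" by (intro tendsto_ennrealI)
      moreover have "ennreal (\<Sum>i<n. \<mu> (B \<inter> A i)) \<le> (\<Sum>i. p (A i))" for n
      proof -
        have "ennreal (\<Sum>i<n. \<mu> (B \<inter> A i)) \<le> ennreal (\<Sum>i<n. max 0 (\<mu> (B \<inter> A i)))"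
          by (intro ennreal_leI sum_mono) auto
        also have "\<dots> = (\<Sum>i<n. ennreal (max 0 (\<mu> (B \<inter> A i))))" by (subst sum_ennreal) auto
        also have "\<dots> = (\<Sum>i<n. ennreal (\<mu> (B \<inter> A i)))"
          by (intro sum.cong refl) (auto simp: max_def ennreal_neg)
        also have "\<dots> \<le> (\<Sum>i<n. p (A i))"
          using A B by (intro sum_mono p_upper) auto
        also have "\<dots> \<le> (\<Sum>i. p (A i))" by (intro sum_le_suminf) auto
        finally show ?thesis .
      qed
      ultimately show "ennreal (\<mu> B) \<le> (\<Sum>i. p (A i))"
        by (intro LIMSEQ_le_const2) auto
    qed
    ultimately show "(\<Sum>i. p (A i)) = p (\<Union>i. A i)" by (rule antisym)
  qed
  moreover have "positive (borel_sets \<Omega>) p"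
    using signed_measures_empty[OF \<mu>] by (auto simp: positive_def p_def SUP_constant)
  ultimately have "emeasure (measure_of \<Omega> (borel_sets \<Omega>) p) A = p A"
    using A by (intro emeasure_measure_of_sigma sigma_algebra_borel_sets)
  then show ?thesis unfolding pos_part_def p_def .
qed

text \<open>
  Real-valued countable additivity rules out infinite positive parts: a set of infinite positive
  part contains a smaller one, again of infinite positive part, such that \<open>\<bar>\<mu>\<bar> > 1\<close> on the difference.
  Iterating produces disjoint differences along which \<open>\<mu>\<close> does not tend to zero.
\<close>

lemma finite_pos_part:
  assumes \<mu>: "\<mu> \<in> signed_measures \<Omega>"
  shows "finite_measure (pos_part \<Omega> \<mu>)"
proof (rule finite_measureI, rule notI)
  let ?P = "pos_part \<Omega> \<mu>"
  let ?Q = "\<lambda>E. E \<in> borel_sets \<Omega> \<and> emeasure ?P E = \<infinity>"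
  assume "emeasure ?P (space ?P) = \<infinity>"
  then have \<Omega>: "?Q \<Omega>" using sets.top[of ?P] by simp
  have step: "\<exists>F. ?Q F \<and> F \<subseteq> E \<and> \<bar>\<mu> (E - F)\<bar> > 1" if E: "?Q E" for E
  proof -
    have "ennreal (1 + \<bar>\<mu> E\<bar>) < emeasure ?P E" using E by simp
    then obtain B where B: "B \<in> borel_sets \<Omega>" "B \<subseteq> E" "ennreal (1 + \<bar>\<mu> E\<bar>) < ennreal (\<mu> B)"
      using E unfolding emeasure_pos_part[OF \<mu> conjunct1[OF E]] less_SUP_iff by blast
    have b: "1 + \<bar>\<mu> E\<bar> < \<mu> B" using B(3) by (subst (asm) ennreal_less_iff) auto
    have d: "\<mu> (E - B) = \<mu> E - \<mu> B" using E B by (intro signed_measures_Diff[OF \<mu>]) auto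
    have "emeasure ?P (B \<union> (E - B)) = emeasure ?P B + emeasure ?P (E - B)"
      using E B by (intro plus_emeasure[symmetric]) auto
    moreover have "B \<union> (E - B) = E" using B by auto
    ultimately have "emeasure ?P B = \<infinity> \<or> emeasure ?P (E - B) = \<infinity>"
      using E by (metis ennreal_add_eq_top infinity_ennreal_def)
    then show ?thesis
    proof
      assume "emeasure ?P B = \<infinity>"
      then show ?thesis using B b d by (intro exI[of _ B]) auto
    next
      assume "emeasure ?P (E - B) = \<infinity>"
      moreover have "E - (E - B) = B" using B by auto
      ultimately show ?thesis using B E b by (intro exI[of _ "E - B"]) auto
    qed
  qed
  obtain E where E: "\<And>n::nat. ?Q (E n)" "\<And>n. E (Suc n) \<subseteq> E n \<and> \<bar>\<mu> (E n - E (Suc n))\<bar> > 1"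
    using dependent_nat_choice[of "\<lambda>n. ?Q" "\<lambda>n E F. F \<subseteq> E \<and> \<bar>\<mu> (E - F)\<bar> > 1"] \<Omega> step by metis
  have dec: "decseq E" using E(2) by (intro decseq_SucI) auto
  have "disjoint_family (\<lambda>n. E n - E (Suc n))"
    unfolding disjoint_family_on_def
  proof (intro ballI impI)
    fix m n :: nat assume "m \<noteq> n"
    then have "Suc m \<le> n \<or> Suc n \<le> m" by auto
    then show "(E m - E (Suc m)) \<inter> (E n - E (Suc n)) = {}"
      using decseqD[OF dec, of "Suc m" n] decseqD[OF dec, of "Suc n" m] by auto
  qed
  then have "summable (\<lambda>n. \<mu> (E n - E (Suc n)))"
    using E(1) by (intro sums_summable[OF signed_measures_sums[OF \<mu>]]) auto
  then have "(\<lambda>n. \<bar>\<mu> (E n - E (Suc n))\<bar>) \<longlonglongrightarrow> 0"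
    using summable_LIMSEQ_zero tendsto_rabs_zero by blast
  then have "1 \<le> (0::real)"
    using E(2) by (intro LIMSEQ_le_const[of _ 0 1]) (auto intro: less_imp_le)
  then show False by simp
qed

lemma finite_neg_part: "\<mu> \<in> signed_measures \<Omega> \<Longrightarrow> finite_measure (neg_part \<Omega> \<mu>)"
  unfolding neg_part_def by (intro finite_pos_part signed_measures_uminus)

lemma measure_pos_part_upper:
  assumes \<mu>: "\<mu> \<in> signed_measures \<Omega>" and "A \<in> borel_sets \<Omega>" "B \<in> borel_sets \<Omega>" "B \<subseteq> A"
  shows "\<mu> B \<le> measure (pos_part \<Omega> \<mu>) A"
proof -
  interpret finite_measure "pos_part \<Omega> \<mu>" by (rule finite_pos_part[OF \<mu>])
  have "ennreal (\<mu> B) \<le> emeasure (pos_part \<Omega> \<mu>) A"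
    using assms by (subst emeasure_pos_part[OF \<mu>]) (auto intro!: SUP_upper)
  then show ?thesis
    using measure_nonneg[of "pos_part \<Omega> \<mu>" A] by (simp add: emeasure_eq_measure)
qed

lemma measure_pos_part_approx:
  assumes \<mu>: "\<mu> \<in> signed_measures \<Omega>" and A: "A \<in> borel_sets \<Omega>" and c: "c < measure (pos_part \<Omega> \<mu>) A"
  obtains B where "B \<in> borel_sets \<Omega>" "B \<subseteq> A" "c < \<mu> B"
proof (cases "c < 0")
  case True
  then show ?thesis using that[of "{}"] signed_measures_empty[OF \<mu>] by auto
next
  case False
  interpret finite_measure "pos_part \<Omega> \<mu>" by (rule finite_pos_part[OF \<mu>])
  have "ennreal c < emeasure (pos_part \<Omega> \<mu>) A"
    using c False by (simp add: emeasure_eq_measure ennreal_less_iff)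
  then obtain B where "B \<in> borel_sets \<Omega>" "B \<subseteq> A" "ennreal c < ennreal (\<mu> B)"
    unfolding emeasure_pos_part[OF \<mu> A] less_SUP_iff by blast
  then show ?thesis using that False by (simp add: ennreal_less_iff)
qed

lemma measure_pos_part_le:
  assumes \<mu>: "\<mu> \<in> signed_measures \<Omega>" and A: "A \<in> borel_sets \<Omega>"
    and le: "\<And>B. B \<in> borel_sets \<Omega> \<Longrightarrow> B \<subseteq> A \<Longrightarrow> \<mu> B \<le> c"
  shows "measure (pos_part \<Omega> \<mu>) A \<le> c"
proof (rule ccontr)
  assume "\<not> measure (pos_part \<Omega> \<mu>) A \<le> c"
  then obtain B where "B \<in> borel_sets \<Omega>" "B \<subseteq> A" "c < \<mu> B"
    using measure_pos_part_approx[OF \<mu> A, of c] by (auto simp: not_le)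
  then show False using le[of B] by simp
qed

text \<open>
  Complementation in \<open>A\<close> exchanges the two suprema, since \<open>\<mu> B = \<mu> A - \<mu> (A - B)\<close>.
\<close>

lemma Jordan_decomposition:
  assumes \<mu>: "\<mu> \<in> signed_measures \<Omega>" and A: "A \<in> borel_sets \<Omega>"
  shows "\<mu> A = measure (pos_part \<Omega> \<mu>) A - measure (neg_part \<Omega> \<mu>) A"
proof -
  have half: "measure (pos_part \<Omega> \<nu>) A \<le> \<nu> A + measure (pos_part \<Omega> (\<lambda>A. - \<nu> A)) A"
    if \<nu>: "\<nu> \<in> signed_measures \<Omega>" for \<nu>
  proof (rule measure_pos_part_le[OF \<nu> A])
    fix B assume B: "B \<in> borel_sets \<Omega>" "B \<subseteq> A"
    have "- \<nu> (A - B) \<le> measure (pos_part \<Omega> (\<lambda>A. - \<nu> A)) A"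
      using A B by (intro measure_pos_part_upper[OF signed_measures_uminus[OF \<nu>]]) auto
    then show "\<nu> B \<le> \<nu> A + measure (pos_part \<Omega> (\<lambda>A. - \<nu> A)) A"
      by (simp add: signed_measures_Diff[OF \<nu> A B])
  qed
  show ?thesis
    using half[OF \<mu>] half[OF signed_measures_uminus[OF \<mu>]] by (simp add: neg_part_def)
qed

section \<open>The pairing as a limit of level sums\<close>

text \<open>
  This is the integral of \<open>\<lfloor>n f\<rfloor> / n\<close>, written so that it makes sense for an arbitrary set function
  \<open>\<mu>\<close>. The bound \<open>m\<close> on \<open>\<bar>f\<bar>\<close> keeps the sum finite.
\<close>

definition level_sum :: "'a::euclidean_space set \<Rightarrow> ('a \<Rightarrow> real) \<Rightarrow> nat \<Rightarrow> ('a set \<Rightarrow> real) \<Rightarrow> nat \<Rightarrow> real" where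
  "level_sum \<Omega> f m \<mu> n = (\<Sum>j\<in>{- int (m * n)..int (m * n)}. j / n * \<mu> {w \<in> \<Omega>. \<lfloor>n * f w\<rfloor> = j})"

text \<open>
  The image under \<open>\<pi>\<close> of the signed measure \<open>g M\<close>, restricted to \<open>\<Omega>\<close>. It covers finite measures,
  measures with a density, and the weak-star limits constructed below.
\<close>

definition weighted_image ::
  "'a::euclidean_space set \<Rightarrow> 'b measure \<Rightarrow> ('b \<Rightarrow> 'a) \<Rightarrow> ('b \<Rightarrow> real) \<Rightarrow> 'a set \<Rightarrow> real" where
  "weighted_image \<Omega> M \<pi> g = (\<lambda>A. if A \<in> borel_sets \<Omega> then LINT z|M. indicator A (\<pi> z) * g z else 0)"

lemma borel_sets_borel:
  assumes "\<Omega> \<in> sets borel" "A \<in> borel_sets \<Omega>" shows "A \<in> sets borel"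
  using assms by (auto simp: sets_restrict_space_iff)

lemma level_set_borel:
  fixes f :: "'a::euclidean_space \<Rightarrow> real"
  assumes "f \<in> borel_measurable (restrict_space borel \<Omega>)"
  shows "{w \<in> \<Omega>. \<lfloor>n * f w\<rfloor> = (j::int)} \<in> borel_sets \<Omega>"
proof -
  have "{w \<in> space (restrict_space borel \<Omega>). \<lfloor>n * f w\<rfloor> = j} \<in> borel_sets \<Omega>"
  proof -
    have [measurable]: "f \<in> borel_measurable (restrict_space borel \<Omega>)" by fact
    show ?thesis unfolding floor_eq_iff by measurable
  qed
  then show ?thesis by (simp add: space_restrict_space)
qed

lemma integrable_indicator_mult:
  fixes g :: "'b \<Rightarrow> real"
  assumes "integrable M g" "\<pi> \<in> borel_measurable M" "A \<in> sets borel"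
  shows "integrable M (\<lambda>z. indicator A (\<pi> z) * g z)"
proof -
  have [measurable]: "\<pi> \<in> borel_measurable M" "A \<in> sets borel" "g \<in> borel_measurable M"
    using assms by auto
  show ?thesis
    by (rule Bochner_Integration.integrable_bound[OF assms(1)]) (auto simp: indicator_def)
qed

text \<open>
  The functions \<open>\<lfloor>n f\<rfloor> / n\<close> and \<open>f\<close> differ by at most \<open>1 / n\<close>, so the level sums differ from the integral by at
  most \<open>\<integral>\<bar>g\<bar> / n\<close>.
\<close>

lemma level_sum_weighted_image:
  assumes \<Omega>: "\<Omega> \<in> sets borel" and f: "f \<in> borel_measurable (restrict_space borel \<Omega>)"
    and bnd: "\<And>w. w \<in> \<Omega> \<Longrightarrow> \<bar>f w\<bar> \<le> real m"
    and \<pi>: "\<pi> \<in> borel_measurable M" and g: "integrable M g"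
  shows "(\<lambda>n. level_sum \<Omega> f m (weighted_image \<Omega> M \<pi> g) n)
    \<longlonglongrightarrow> (LINT z|M. indicator \<Omega> (\<pi> z) * f (\<pi> z) * g z)"
proof -
  note [measurable] = \<Omega> \<pi>
  have [measurable]: "g \<in> borel_measurable M" using g by auto
  have f': "(\<lambda>w. indicator \<Omega> w * f w) \<in> borel_measurable borel"
    using f \<Omega> by (simp add: borel_measurable_restrict_space_iff)
  then have fm [measurable]: "(\<lambda>z. indicator \<Omega> (\<pi> z) * f (\<pi> z)) \<in> borel_measurable M"
    using measurable_compose[OF \<pi> f'] by simp
  let ?I = "LINT z|M. indicator \<Omega> (\<pi> z) * f (\<pi> z) * g z"
  let ?G = "LINT z|M. \<bar>g z\<bar>"
  have ifg: "integrable M (\<lambda>z. indicator \<Omega> (\<pi> z) * f (\<pi> z) * g z)"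
  proof (rule Bochner_Integration.integrable_bound[OF integrable_mult_right[OF g, of "real m"]])
    show "AE x in M. norm (indicator \<Omega> (\<pi> x) * f (\<pi> x) * g x) \<le> norm (real m * g x)"
      using bnd by (auto simp: abs_mult indicator_def intro!: mult_right_mono)
  qed simp
  have est: "\<bar>level_sum \<Omega> f m (weighted_image \<Omega> M \<pi> g) n - ?I\<bar> \<le> ?G * (1 / n)" if n: "n > 0" for n :: nat
  proof -
    define S where "S j = {w \<in> \<Omega>. \<lfloor>n * f w\<rfloor> = (j::int)}" for j
    let ?J = "{- int (m * n)..int (m * n)}"
    have S: "S j \<in> borel_sets \<Omega>" for j unfolding S_def by (rule level_set_borel[OF f])
    have Sb: "S j \<in> sets borel" for j using borel_sets_borel[OF \<Omega> S] .
    have iS: "integrable M (\<lambda>z. indicator (S j) (\<pi> z) * g z)" for j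
      by (rule integrable_indicator_mult[OF g \<pi> Sb])
    have "level_sum \<Omega> f m (weighted_image \<Omega> M \<pi> g) n
        = (\<Sum>j\<in>?J. j / n * (LINT z|M. indicator (S j) (\<pi> z) * g z))"
      using S unfolding level_sum_def weighted_image_def S_def[symmetric] by simp
    also have "\<dots> = (LINT z|M. (\<Sum>j\<in>?J. j / n * (indicator (S j) (\<pi> z) * g z)))"
      using iS by (subst Bochner_Integration.integral_sum) auto
    finally have eq: "level_sum \<Omega> f m (weighted_image \<Omega> M \<pi> g) n
        = (LINT z|M. (\<Sum>j\<in>?J. j / n * (indicator (S j) (\<pi> z) * g z)))" .
    have pw: "\<bar>(\<Sum>j\<in>?J. j / n * (indicator (S j) (\<pi> z) * g z)) - indicator \<Omega> (\<pi> z) * f (\<pi> z) * g z\<bar>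
       \<le> \<bar>g z\<bar> * (1 / n)" for z
    proof (cases "\<pi> z \<in> \<Omega>")
      case True
      let ?k = "\<lfloor>n * f (\<pi> z)\<rfloor>"
      have "\<bar>real n * f (\<pi> z)\<bar> \<le> real m * real n"
        using mult_left_mono[OF bnd[OF True], of "real n"] by (simp add: abs_mult mult.commute)
      then have k: "?k \<in> ?J" by (auto simp: le_floor_iff floor_le_iff)
      have "(\<Sum>j\<in>?J. j / n * (indicator (S j) (\<pi> z) * g z))
          = (\<Sum>j\<in>?J. if ?k = j then ?k / n * g z else 0)"
        using True by (intro sum.cong refl) (auto simp: S_def indicator_def)
      also have "\<dots> = ?k / n * g z" using k by (subst sum.delta') auto
      finally have "\<bar>(\<Sum>j\<in>?J. j / n * (indicator (S j) (\<pi> z) * g z)) - indicator \<Omega> (\<pi> z) * f (\<pi> z) * g z\<bar>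
          = \<bar>g z\<bar> * \<bar>?k / n - f (\<pi> z)\<bar>"
        using True by (simp add: abs_mult[symmetric] right_diff_distrib mult.commute)
      also have "?k / n - f (\<pi> z) = (?k - n * f (\<pi> z)) / n"
        using n by (simp add: diff_divide_distrib)
      also have "\<bar>\<dots>\<bar> = \<bar>?k - n * f (\<pi> z)\<bar> / n"
        by (simp only: abs_divide abs_of_nat)
      also have "\<dots> \<le> 1 / n" by (intro divide_right_mono) linarith+
      finally show ?thesis by (simp add: mult_left_mono)
    next
      case False
      then have "indicator (S j) (\<pi> z) = (0::real)" for j by (auto simp: S_def)
      then show ?thesis using False by simp
    qed
    have "level_sum \<Omega> f m (weighted_image \<Omega> M \<pi> g) n - ?I
        = (LINT z|M. (\<Sum>j\<in>?J. j / n * (indicator (S j) (\<pi> z) * g z)) - indicator \<Omega> (\<pi> z) * f (\<pi> z) * g z)"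
      unfolding eq using ifg iS
      by (intro Bochner_Integration.integral_diff[symmetric] Bochner_Integration.integrable_sum integrable_mult_right) auto
    also have "\<bar>\<dots>\<bar> \<le> (LINT z|M. \<bar>g z\<bar> * (1 / n))"
    proof (rule order_trans[OF integral_abs_bound integral_mono])
      show "integrable M (\<lambda>z. \<bar>(\<Sum>j\<in>?J. j / n * (indicator (S j) (\<pi> z) * g z)) - indicator \<Omega> (\<pi> z) * f (\<pi> z) * g z\<bar>)"
        using ifg iS by (intro integrable_abs Bochner_Integration.integrable_diff Bochner_Integration.integrable_sum integrable_mult_right) auto
      show "integrable M (\<lambda>z. \<bar>g z\<bar> * (1 / n))" using g by (intro integrable_mult_left integrable_abs)
    qed (rule pw)
    finally show ?thesis by simp
  qed
  have "(\<lambda>n. level_sum \<Omega> f m (weighted_image \<Omega> M \<pi> g) n - ?I) \<longlonglongrightarrow> 0"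
  proof (rule Lim_null_comparison)
    show "(\<lambda>n. ?G * (1 / real n)) \<longlonglongrightarrow> 0"
      using tendsto_mult[OF tendsto_const lim_1_over_n, of ?G] by simp
  next
    show "\<forall>\<^sub>F n in sequentially. norm (level_sum \<Omega> f m (weighted_image \<Omega> M \<pi> g) n - ?I) \<le> ?G * (1 / real n)"
      using eventually_gt_at_top[of 0] by eventually_elim (use est in simp)
  qed
  then show ?thesis by (rule LIM_zero_cancel)
qed

lemma level_sum_finite_measure:
  assumes "\<Omega> \<in> sets borel" "f \<in> borel_measurable (restrict_space borel \<Omega>)"
    and "\<And>w. w \<in> \<Omega> \<Longrightarrow> \<bar>f w\<bar> \<le> real m"
    and P: "finite_measure P" "sets P = borel_sets \<Omega>"
  shows "(\<lambda>n. level_sum \<Omega> f m (measure P) n) \<longlonglongrightarrow> (LINT w|P. f w)"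
proof -
  have sp: "space P = \<Omega>" using sets_eq_imp_space_eq[OF P(2)] by (simp add: space_restrict_space)
  have id: "(\<lambda>w. w) \<in> borel_measurable P"
    using P(2) measurable_restrict_space1[OF measurable_ident, of borel \<Omega>] by (simp cong: measurable_cong_sets add: id_def)
  interpret finite_measure P by fact
  have w: "weighted_image \<Omega> P (\<lambda>w. w) (\<lambda>_. 1) A = measure P A" if "A \<in> borel_sets \<Omega>" for A
    using that P(2) by (simp add: weighted_image_def)
  have "level_sum \<Omega> f m (weighted_image \<Omega> P (\<lambda>w. w) (\<lambda>_. 1)) = level_sum \<Omega> f m (measure P)"
    by (intro ext) (simp add: level_sum_def w level_set_borel[OF assms(2)])
  moreover have "(LINT w|P. indicator \<Omega> w * f w * 1) = (LINT w|P. f w)"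
    by (intro Bochner_Integration.integral_cong) (auto simp: sp)
  ultimately show ?thesis
    using level_sum_weighted_image[OF assms(1,2,3) id, of "\<lambda>_. 1"] by simp
qed

lemma level_sum_linear:
  "level_sum \<Omega> f m (\<lambda>A. a * \<mu> A + b * \<nu> A) n = a * level_sum \<Omega> f m \<mu> n + b * level_sum \<Omega> f m \<nu> n"
  by (simp add: level_sum_def sum_distrib_left sum.distrib[symmetric] algebra_simps)

lemma level_sum_pairing:
  assumes "\<Omega> \<in> sets borel" "f \<in> borel_measurable (restrict_space borel \<Omega>)"
    and "\<And>w. w \<in> \<Omega> \<Longrightarrow> \<bar>f w\<bar> \<le> real m" and \<mu>: "\<mu> \<in> signed_measures \<Omega>"
  shows "(\<lambda>n. level_sum \<Omega> f m \<mu> n) \<longlonglongrightarrow> pairing \<Omega> f \<mu>"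
proof -
  have "level_sum \<Omega> f m \<mu> n =
      level_sum \<Omega> f m (\<lambda>A. 1 * measure (pos_part \<Omega> \<mu>) A + (-1) * measure (neg_part \<Omega> \<mu>) A) n" for n
    unfolding level_sum_def using level_set_borel[OF assms(2)]
    by (intro sum.cong refl) (simp add: Jordan_decomposition[OF \<mu>])
  then have eq: "level_sum \<Omega> f m \<mu> n =
      level_sum \<Omega> f m (measure (pos_part \<Omega> \<mu>)) n - level_sum \<Omega> f m (measure (neg_part \<Omega> \<mu>)) n" for n
    by (simp add: level_sum_linear[of \<Omega> f m 1 _ "-1", simplified])
  show ?thesis unfolding eq pairing_def
    using assms by (intro tendsto_diff level_sum_finite_measure finite_pos_part finite_neg_part) auto
qed

text \<open>
  Positive and negative parts are not additive in the measure. The level sums are linear in \<open>\<mu>\<close>,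
  and so is their limit.
\<close>

lemma pairing_linear:
  assumes "\<Omega> \<in> sets borel" "f \<in> borel_measurable (restrict_space borel \<Omega>)"
    and "\<And>w. w \<in> \<Omega> \<Longrightarrow> \<bar>f w\<bar> \<le> B"
    and \<mu>: "\<mu> \<in> signed_measures \<Omega>" "\<nu> \<in> signed_measures \<Omega>"
  shows "pairing \<Omega> f (\<lambda>A. a * \<mu> A + b * \<nu> A) = a * pairing \<Omega> f \<mu> + b * pairing \<Omega> f \<nu>"
proof -
  obtain m where "B \<le> real m" using real_arch_simple by blast
  then have bnd: "\<And>w. w \<in> \<Omega> \<Longrightarrow> \<bar>f w\<bar> \<le> real m" using assms(3) by force
  have lim: "(\<lambda>n. level_sum \<Omega> f m \<rho> n) \<longlonglongrightarrow> pairing \<Omega> f \<rho>" if "\<rho> \<in> signed_measures \<Omega>" for \<rho>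
    using level_sum_pairing[OF assms(1,2) bnd that] .
  have "(\<lambda>n. level_sum \<Omega> f m (\<lambda>A. a * \<mu> A + b * \<nu> A) n) \<longlonglongrightarrow> a * pairing \<Omega> f \<mu> + b * pairing \<Omega> f \<nu>"
    unfolding level_sum_linear by (intro tendsto_intros lim \<mu>)
  with lim[OF signed_measures_linear[OF \<mu>]] show ?thesis by (rule LIMSEQ_unique)
qed

lemma weighted_image_signed:
  assumes \<Omega>: "\<Omega> \<in> sets borel" and \<pi>: "\<pi> \<in> borel_measurable M" and g: "integrable M g"
  shows "weighted_image \<Omega> M \<pi> g \<in> signed_measures \<Omega>"
  unfolding signed_measures_def
proof (intro CollectI conjI allI impI)
  fix A :: "nat \<Rightarrow> 'a set"
  assume A: "range A \<subseteq> borel_sets \<Omega> \<and> disjoint_family A"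
  note [measurable] = \<pi>
  have [measurable]: "g \<in> borel_measurable M" using g by auto
  have AS: "A n \<in> borel_sets \<Omega>" for n using A by auto
  have Ab [measurable]: "A n \<in> sets borel" for n using borel_sets_borel[OF \<Omega> AS] .
  have U: "(\<Union>n. A n) \<in> borel_sets \<Omega>" using AS by (intro sets.countable_UN) auto
  have "(\<Sum>i<n. weighted_image \<Omega> M \<pi> g (A i)) = (LINT z|M. indicator (\<Union>i<n. A i) (\<pi> z) * g z)" for n
  proof -
    have d: "disjoint_family_on A {..<n}" using A by (auto simp: disjoint_family_on_def)
    show ?thesis
      unfolding indicator_UN_disjoint[OF finite_lessThan d] sum_distrib_right
      using integrable_indicator_mult[OF g \<pi> Ab] AS
      by (subst Bochner_Integration.integral_sum) (auto simp: weighted_image_def)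
  qed
  moreover have "(\<lambda>n. LINT z|M. indicator (\<Union>i<n. A i) (\<pi> z) * g z) \<longlonglongrightarrow> (LINT z|M. indicator (\<Union>n. A n) (\<pi> z) * g z)"
  proof (rule integral_dominated_convergence[where w="\<lambda>z. \<bar>g z\<bar>"])
    show "AE z in M. (\<lambda>n. indicator (\<Union>i<n. A i) (\<pi> z) * g z) \<longlonglongrightarrow> indicator (\<Union>n. A n) (\<pi> z) * g z"
      by (intro AE_I2 tendsto_intros LIMSEQ_indicator_UN)
  qed (use g in \<open>auto simp: indicator_def\<close>)
  ultimately show "(\<lambda>n. weighted_image \<Omega> M \<pi> g (A n)) sums weighted_image \<Omega> M \<pi> g (\<Union>n. A n)"
    using U by (simp add: sums_def weighted_image_def)
qed (auto simp: weighted_image_def)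

text \<open>
  Both sides are limits of the same level sums, so the Jordan decomposition of the image measure
  does not have to be computed.
\<close>

lemma pairing_weighted_image:
  assumes "\<Omega> \<in> sets borel" "f \<in> borel_measurable (restrict_space borel \<Omega>)"
    and "\<And>w. w \<in> \<Omega> \<Longrightarrow> \<bar>f w\<bar> \<le> B"
    and "\<pi> \<in> borel_measurable M" "integrable M g"
  shows "pairing \<Omega> f (weighted_image \<Omega> M \<pi> g) = (LINT z|M. indicator \<Omega> (\<pi> z) * f (\<pi> z) * g z)"
proof -
  obtain m where "B \<le> real m" using real_arch_simple by blast
  then have bnd: "\<And>w. w \<in> \<Omega> \<Longrightarrow> \<bar>f w\<bar> \<le> real m" using assms(3) by force
  show ?thesis
    using level_sum_pairing[OF assms(1,2) bnd weighted_image_signed[OF assms(1,4,5)]]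
      level_sum_weighted_image[OF assms(1,2) bnd assms(4,5)] by (rule LIMSEQ_unique)
qed

section \<open>Inner regularity\<close>

text \<open>
  Regularity of finite Borel measures on complete separable metric spaces, transported from the
  whole space to the trace \<open>\<sigma>\<close>-algebra on \<open>\<Omega>\<close>.
\<close>

lemma compact_inner_approx:
  assumes \<Omega>: "\<Omega> \<in> sets borel" and P: "finite_measure P" "sets P = borel_sets \<Omega>"
    and A: "A \<in> borel_sets \<Omega>" and e: "(e::real) > 0"
  obtains K where "compact K" "K \<subseteq> A" "measure P (A - K) < e"
proof -
  have sp: "space P = \<Omega>" using sets_eq_imp_space_eq[OF P(2)] by (simp add: space_restrict_space)
  interpret finite_measure P by fact
  have id: "(\<lambda>w. w) \<in> borel_measurable P"
    using P(2) measurable_restrict_space1[OF measurable_ident, of borel \<Omega>] by (simp cong: measurable_cong_sets add: id_def)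
  let ?P' = "distr P borel (\<lambda>w. w)"
  have Ab: "A \<in> sets borel" by (rule borel_sets_borel[OF \<Omega> A])
  have Kb: "K \<in> borel_sets \<Omega>" if "compact K" "K \<subseteq> A" for K
    using that borel_sets_subset[OF A] borel_compact[of K] \<Omega> by (simp add: sets_restrict_space_iff)
  have em: "emeasure ?P' K = emeasure P K" if "K \<in> borel_sets \<Omega>" for K
    using that borel_sets_borel[OF \<Omega> that] borel_sets_subset[OF that] 
    by (subst emeasure_distr[OF id]) (auto simp: sp Int_absorb2)
  obtain K where K: "compact K" "K \<subseteq> A" "emeasure P A < emeasure P K + ennreal e"
  proof (cases "emeasure P A = 0")
    case True then show ?thesis using e that[of "{}"] by simp
  next
    case False
    have pos: "0 < measure P A" using False by (simp add: emeasure_eq_measure zero_less_measure_iff)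
    have "emeasure ?P' (space ?P') \<noteq> \<infinity>" 
      using finite_measure.emeasure_finite[OF finite_measure_distr[OF id]] by simp
    then have "emeasure P A = (SUP K \<in> {K. K \<subseteq> A \<and> compact K}. emeasure ?P' K)"
      using inner_regular[of ?P' A] Ab em[OF A] by simp
    moreover have "ennreal (measure P A - min e (measure P A)) < emeasure P A"
      using pos e by (simp add: emeasure_eq_measure ennreal_less_iff)
    ultimately obtain K where K: "K \<subseteq> A" "compact K" "ennreal (measure P A - min e (measure P A)) < emeasure ?P' K"
      by (auto simp: less_SUP_iff)
    have "measure P A - min e (measure P A) < measure P K"
      using K pos e em[OF Kb[OF K(2,1)]] by (simp add: emeasure_eq_measure ennreal_less_iff)
    then have "measure P A < measure P K + e" by linarith
    then have "emeasure P A < emeasure P K + ennreal e"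
      using e by (simp add: emeasure_eq_measure ennreal_less_iff flip: ennreal_plus)
    then show ?thesis using that K by blast
  qed
  have "measure P A < measure P K + e"
    using K(3) e by (simp add: emeasure_eq_measure ennreal_less_iff flip: ennreal_plus)
  moreover have "measure P (A - K) = measure P A - measure P K"
    using A Kb[OF K(1,2)] K(2) P(2) by (intro finite_measure_Diff) auto
  ultimately show ?thesis using that K by simp
qed

lemma radon_eq_signed_measures:
  assumes \<Omega>: "\<Omega> \<in> sets borel" shows "radon \<Omega> = signed_measures \<Omega>"
proof
  show "signed_measures \<Omega> \<subseteq> radon \<Omega>"
  proof
    fix \<mu> assume \<mu>: "\<mu> \<in> signed_measures \<Omega>"
    have "\<exists>K. compact K \<and> K \<subseteq> A \<and> variation \<Omega> \<mu> (A - K) < e" if A: "A \<in> borel_sets \<Omega>" and e: "e > 0" for A and e :: real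
    proof -
      interpret P: finite_measure "pos_part \<Omega> \<mu>" by (rule finite_pos_part[OF \<mu>])
      interpret N: finite_measure "neg_part \<Omega> \<mu>" by (rule finite_neg_part[OF \<mu>])
      obtain K where K: "compact K" "K \<subseteq> A" "measure (pos_part \<Omega> \<mu>) (A - K) < e / 2"
        using compact_inner_approx[OF \<Omega> P.finite_measure_axioms _ A, of "e/2"] e by auto
      obtain L where L: "compact L" "L \<subseteq> A" "measure (neg_part \<Omega> \<mu>) (A - L) < e / 2"
        using compact_inner_approx[OF \<Omega> N.finite_measure_axioms _ A, of "e/2"] e by auto
      have KL: "K \<in> borel_sets \<Omega>" "L \<in> borel_sets \<Omega>"
        using K L borel_sets_subset[OF A] borel_compact \<Omega> by (auto simp: sets_restrict_space_iff)
      have "measure (pos_part \<Omega> \<mu>) (A - (K \<union> L)) \<le> measure (pos_part \<Omega> \<mu>) (A - K)"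
        "measure (neg_part \<Omega> \<mu>) (A - (K \<union> L)) \<le> measure (neg_part \<Omega> \<mu>) (A - L)"
        using KL A by (auto intro!: P.finite_measure_mono N.finite_measure_mono)
      then have "variation \<Omega> \<mu> (A - (K \<union> L)) < e"
        using K L by (simp add: variation_def)
      then show ?thesis using K L by (intro exI[of _ "K \<union> L"]) auto
    qed
    then show "\<mu> \<in> radon \<Omega>" using \<mu> by (auto simp: radon_def)
  qed
qed (auto simp: radon_def)

section \<open>Continuous functions vanishing at the boundary\<close>

lemma Cc_extension_continuous:
  assumes \<Omega>: "open \<Omega>" and g: "g \<in> Cc \<Omega>"
  shows "continuous_on UNIV (\<lambda>w. if w \<in> \<Omega> then g w else 0)"
proof -
  obtain K where K: "compact K" "K \<subseteq> \<Omega>" "\<And>w. w \<in> \<Omega> - K \<Longrightarrow> g w = 0" and c: "continuous_on \<Omega> g"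
    using g by (auto simp: Cc_def)
  let ?g = "\<lambda>w. if w \<in> \<Omega> then g w else 0"
  have "continuous_on (- K) ?g"
    by (rule continuous_on_eq[of _ "\<lambda>_. 0"]) (use K in auto)
  moreover have "continuous_on \<Omega> ?g"
    by (rule continuous_on_eq[OF c]) auto
  moreover have "\<Omega> \<union> - K = UNIV" using K by auto
  ultimately show ?thesis
    using continuous_on_open_Un[OF \<Omega>, of "- K" ?g] K(1) by (simp add: compact_imp_closed open_Compl)
qed

lemma C0_extension_continuous:
  assumes \<Omega>: "open \<Omega>" and f: "f \<in> C0 \<Omega>"
  shows "continuous_on UNIV (\<lambda>w. if w \<in> \<Omega> then f w else 0)"
proof -
  have "\<exists>g\<in>Cc \<Omega>. \<forall>w\<in>\<Omega>. \<bar>f w - g w\<bar> \<le> inverse (real (Suc n))" for n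
    using f by (auto simp: C0_def)
  then obtain g where g: "\<And>n. g n \<in> Cc \<Omega>" "\<And>n w. w \<in> \<Omega> \<Longrightarrow> \<bar>f w - g n w\<bar> \<le> inverse (real (Suc n))"
    by metis
  have "uniform_limit UNIV (\<lambda>n w. if w \<in> \<Omega> then g n w else 0) (\<lambda>w. if w \<in> \<Omega> then f w else 0) sequentially"
  proof (rule uniform_limitI)
    fix e :: real assume "e > 0"
    then have "\<forall>\<^sub>F n in sequentially. inverse (real (Suc n)) < e"
      using LIMSEQ_inverse_real_of_nat by (auto simp: tendsto_iff dist_real_def)
    then show "\<forall>\<^sub>F n in sequentially. \<forall>w\<in>UNIV. dist (if w \<in> \<Omega> then g n w else 0) (if w \<in> \<Omega> then f w else 0) < e"
    proof eventually_elim
      case (elim n)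
      then show ?case using g(2)[of _ n] \<open>e > 0\<close> by (auto simp: dist_real_def abs_minus_commute intro: le_less_trans)
    qed
  qed
  then show ?thesis
    by (rule uniform_limit_theorem[rotated]) (simp_all add: Cc_extension_continuous[OF \<Omega> g(1)])
qed

lemma C0_continuous_on: "open \<Omega> \<Longrightarrow> f \<in> C0 \<Omega> \<Longrightarrow> continuous_on \<Omega> f"
  by (rule continuous_on_eq[OF continuous_on_subset[OF C0_extension_continuous]]) auto

lemma C0_measurable:
  assumes "open \<Omega>" "f \<in> C0 \<Omega>" shows "f \<in> borel_measurable (restrict_space borel \<Omega>)"
  by (rule borel_measurable_continuous_on_restrict[OF C0_continuous_on[OF assms]])

lemma C0_bounded:
  assumes "f \<in> C0 \<Omega>"
  obtains B where "B > 0" "\<And>w. w \<in> \<Omega> \<Longrightarrow> \<bar>f w\<bar> \<le> B"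
proof -
  obtain g where g: "g \<in> Cc \<Omega>" "\<And>w. w \<in> \<Omega> \<Longrightarrow> \<bar>f w - g w\<bar> \<le> 1"
  proof -
    have "\<forall>e>0. \<exists>g\<in>Cc \<Omega>. \<forall>w\<in>\<Omega>. \<bar>f w - g w\<bar> \<le> e" using assms by (simp add: C0_def)
    then have "\<exists>g\<in>Cc \<Omega>. \<forall>w\<in>\<Omega>. \<bar>f w - g w\<bar> \<le> 1" using zero_less_one by blast
    then show ?thesis using that by blast
  qed
  then obtain K where K: "compact K" "K \<subseteq> \<Omega>" "\<And>w. w \<in> \<Omega> - K \<Longrightarrow> g w = 0" "continuous_on \<Omega> g"
    by (auto simp: Cc_def)
  have "bounded (g ` K)"
    using K by (intro compact_imp_bounded compact_continuous_image) (auto intro: continuous_on_subset)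
  then obtain b where b: "b > 0" "\<And>w. w \<in> K \<Longrightarrow> \<bar>g w\<bar> \<le> b"
    by (auto simp: bounded_pos)
  show ?thesis
  proof (rule that[of "b + 1"])
    fix w assume w: "w \<in> \<Omega>"
    have "\<bar>g w\<bar> \<le> b" using b K(3)[of w] w by (cases "w \<in> K") auto
    then show "\<bar>f w\<bar> \<le> b + 1" using g(2)[OF w] by linarith
  qed (use b in auto)
qed

text \<open>
  The function \<open>f\<close> minus its truncation to \<open>[-e, e]\<close> is supported in the set where \<open>\<bar>f\<bar> \<ge> e\<close>, which is closed,
  bounded and contained in \<open>\<Omega>\<close>.
\<close>

lemma C0I:
  assumes \<Omega>: "bounded \<Omega>" and f: "continuous_on UNIV f" and z: "\<And>w. w \<notin> \<Omega> \<Longrightarrow> f w = 0"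
  shows "f \<in> C0 \<Omega>"
  unfolding C0_def
proof (intro CollectI allI impI)
  fix e :: real assume e: "e > 0"
  define g where "g w = f w - max (- e) (min e (f w))" for w
  let ?K = "{w. e \<le> \<bar>f w\<bar>}"
  have "closed ?K"
    by (intro closed_Collect_le continuous_intros f)
  moreover have sub: "?K \<subseteq> \<Omega>" using z e by force
  ultimately have "compact ?K"
    using \<Omega> bounded_subset by (auto simp: compact_eq_bounded_closed)
  moreover have "continuous_on \<Omega> g"
    unfolding g_def by (intro continuous_intros continuous_on_subset[OF f]) auto
  ultimately have "g \<in> Cc \<Omega>"
    using sub unfolding Cc_def by (intro CollectI conjI exI[of _ ?K]) (auto simp: g_def)
  moreover have "\<forall>w\<in>\<Omega>. \<bar>f w - g w\<bar> \<le> e" using e by (auto simp: g_def)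
  ultimately show "\<exists>g\<in>Cc \<Omega>. \<forall>w\<in>\<Omega>. \<bar>f w - g w\<bar> \<le> e" by blast
qed

text \<open>
  The values outside \<open>\<Omega>\<close> are reset to zero to normalise the representative.
\<close>

lemma C0_linear:
  assumes "f \<in> C0 \<Omega>" "g \<in> C0 \<Omega>" "open \<Omega>" "bounded \<Omega>"
  shows "(\<lambda>w. if w \<in> \<Omega> then a * f w + b * g w else 0) \<in> C0 \<Omega>"
proof (rule C0I)
  have "continuous_on UNIV (\<lambda>w. a * (if w \<in> \<Omega> then f w else 0) + b * (if w \<in> \<Omega> then g w else 0))"
    using assms by (intro continuous_intros C0_extension_continuous)
  then show "continuous_on UNIV (\<lambda>w. if w \<in> \<Omega> then a * f w + b * g w else 0)"
    by (rule continuous_on_eq) auto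
qed (use assms in auto)

lemma pairing_bound:
  assumes f: "f \<in> borel_measurable (restrict_space borel \<Omega>)" and bnd: "\<And>w. w \<in> \<Omega> \<Longrightarrow> \<bar>f w\<bar> \<le> B" and B: "B \<ge> 0"
    and \<mu>: "\<mu> \<in> signed_measures \<Omega>"
  shows "\<bar>pairing \<Omega> f \<mu>\<bar> \<le> B * tv_norm \<Omega> \<mu>"
proof -
  have *: "\<bar>LINT w|P. f w\<bar> \<le> B * measure P \<Omega>" if P: "finite_measure P" "sets P = borel_sets \<Omega>" for P
  proof -
    interpret finite_measure P by fact
    have sp: "space P = \<Omega>" using sets_eq_imp_space_eq[OF P(2)] by (simp add: space_restrict_space)
    have "\<bar>LINT w|P. f w\<bar> \<le> (LINT w|P. B)"
    proof (rule order_trans[OF integral_abs_bound integral_mono])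
      show "integrable P (\<lambda>w. \<bar>f w\<bar>)"
        using bnd f P(2) by (intro integrable_const_bound[where B=B]) (auto simp: sp cong: measurable_cong_sets)
    qed (use bnd sp in auto)
    then show ?thesis by (simp add: sp mult.commute)
  qed
  show ?thesis
    using *[OF finite_pos_part[OF \<mu>]] *[OF finite_neg_part[OF \<mu>]]
    unfolding pairing_def tv_norm_def variation_def by (simp add: distrib_left)
qed

lemma pairing_linear_function:
  assumes f: "f \<in> borel_measurable (restrict_space borel \<Omega>)" "\<And>w. w \<in> \<Omega> \<Longrightarrow> \<bar>f w\<bar> \<le> B"
    and g: "g \<in> borel_measurable (restrict_space borel \<Omega>)" "\<And>w. w \<in> \<Omega> \<Longrightarrow> \<bar>g w\<bar> \<le> C"
    and \<mu>: "\<mu> \<in> signed_measures \<Omega>"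
  shows "pairing \<Omega> (\<lambda>w. if w \<in> \<Omega> then a * f w + b * g w else 0) \<mu> = a * pairing \<Omega> f \<mu> + b * pairing \<Omega> g \<mu>"
proof -
  have *: "(LINT w|P. (if w \<in> \<Omega> then a * f w + b * g w else 0)) = a * (LINT w|P. f w) + b * (LINT w|P. g w)"
    if P: "finite_measure P" "sets P = borel_sets \<Omega>" for P
  proof -
    interpret finite_measure P by fact
    have sp: "space P = \<Omega>" using sets_eq_imp_space_eq[OF P(2)] by (simp add: space_restrict_space)
    have "integrable P f" 
      using f P(2) by (intro integrable_const_bound[where B=B]) (auto simp: sp cong: measurable_cong_sets)
    moreover have "integrable P g" 
      using g P(2) by (intro integrable_const_bound[where B=C]) (auto simp: sp cong: measurable_cong_sets)
    moreover have "(LINT w|P. (if w \<in> \<Omega> then a * f w + b * g w else 0)) = (LINT w|P. a * f w + b * g w)"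
      by (intro Bochner_Integration.integral_cong) (auto simp: sp)
    ultimately show ?thesis by simp
  qed
  show ?thesis
    using *[OF finite_pos_part[OF \<mu>]] *[OF finite_neg_part[OF \<mu>]]
    unfolding pairing_def by (simp add: algebra_simps)
qed

section \<open>Duality between measures and continuous functions\<close>

text \<open>
  The embedding of measures into the dual of \<open>C\<^sub>0\<close> is isometric. Almost all of the positive part
  sits on a compact set \<open>K\<close>, almost all of the negative part on a disjoint compact set \<open>L\<close>, and a Urysohn
  function that is \<open>1\<close> on \<open>K\<close>, \<open>-1\<close> on \<open>L\<close> and \<open>0\<close> outside \<open>\<Omega>\<close> nearly attains the norm.
\<close>

lemma norming_C0_function:
  assumes \<Omega>: "open \<Omega>" "bounded \<Omega>" and \<mu>: "\<mu> \<in> signed_measures \<Omega>" and e: "e > 0"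
  obtains f where "f \<in> C0 \<Omega>" "\<And>w. \<bar>f w\<bar> \<le> 1" "tv_norm \<Omega> \<mu> - e \<le> pairing \<Omega> f \<mu>"
proof -
  have \<Omega>b: "\<Omega> \<in> sets borel" and \<Omega>m: "\<Omega> \<in> borel_sets \<Omega>"
    using \<Omega> by (auto simp: sets_restrict_space_iff)
  interpret P: finite_measure "pos_part \<Omega> \<mu>" by (rule finite_pos_part[OF \<mu>])
  interpret N: finite_measure "neg_part \<Omega> \<mu>" by (rule finite_neg_part[OF \<mu>])
  let ?P = "measure (pos_part \<Omega> \<mu>)" and ?N = "measure (neg_part \<Omega> \<mu>)"
  \<comment> \<open>Each of the two parts loses at most \<open>4 d\<close>.\<close>
  define d where "d = e / 8"
  have d: "d > 0" using e by (simp add: d_def)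
  obtain B where B: "B \<in> borel_sets \<Omega>" "B \<subseteq> \<Omega>" "?P \<Omega> - d < \<mu> B"
    using measure_pos_part_approx[OF \<mu> \<Omega>m, of "?P \<Omega> - d"] d by auto
  have CB: "\<Omega> - B \<in> borel_sets \<Omega>" using B \<Omega>m by auto
  have PB: "?P \<Omega> = ?P B + ?P (\<Omega> - B)"
    using B \<Omega>m by (subst P.finite_measure_Diff) auto
  have NB: "?N B \<le> d" "?P (\<Omega> - B) \<le> d"
    using Jordan_decomposition[OF \<mu> B(1)] B(3) PB measure_nonneg[of "pos_part \<Omega> \<mu>" "\<Omega> - B"]
      measure_nonneg[of "neg_part \<Omega> \<mu>" B] by linarith+
  obtain K where K: "compact K" "K \<subseteq> B" "?P (B - K) < d"
    using compact_inner_approx[OF \<Omega>b P.finite_measure_axioms _ B(1) d] by auto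
  obtain L where L: "compact L" "L \<subseteq> \<Omega> - B" "?N ((\<Omega> - B) - L) < d"
    using compact_inner_approx[OF \<Omega>b N.finite_measure_axioms _ CB d] by auto
  have KL: "K \<in> borel_sets \<Omega>" "L \<in> borel_sets \<Omega>"
    using K L B borel_compact \<Omega>b by (auto simp: sets_restrict_space_iff)
  have "?P (\<Omega> - K) \<le> ?P ((B - K) \<union> (\<Omega> - B))" 
    using KL B CB by (intro P.finite_measure_mono) auto
  also have "\<dots> \<le> ?P (B - K) + ?P (\<Omega> - B)" using KL B CB by (intro measure_Un_le) auto
  finally have PK: "?P (\<Omega> - K) \<le> 2 * d" using K NB by simp
  have "?N (\<Omega> - L) \<le> ?N (((\<Omega> - B) - L) \<union> B)" 
    using KL B CB by (intro N.finite_measure_mono) auto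
  also have "\<dots> \<le> ?N ((\<Omega> - B) - L) + ?N B" using KL B CB by (intro measure_Un_le) auto
  finally have NL: "?N (\<Omega> - L) \<le> 2 * d" using L NB by simp
  have cl: "closed K" "closed L" "closed (- \<Omega>)" using K L \<Omega> by (auto simp: compact_imp_closed)
  obtain f1 :: "'a \<Rightarrow> real" where f1: "continuous_on UNIV f1" "\<And>w. f1 w \<in> closed_segment 0 1"
    "\<And>w. w \<in> L \<union> - \<Omega> \<Longrightarrow> f1 w = 0" "\<And>w. w \<in> K \<Longrightarrow> f1 w = 1"
  proof (rule Urysohn[of "L \<union> - \<Omega>" K 0 "1::real"])
    show "(L \<union> - \<Omega>) \<inter> K = {}" using K L B by auto
  qed (use cl in auto)
  obtain f2 :: "'a \<Rightarrow> real" where f2: "continuous_on UNIV f2" "\<And>w. f2 w \<in> closed_segment 0 1"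
    "\<And>w. w \<in> K \<union> - \<Omega> \<Longrightarrow> f2 w = 0" "\<And>w. w \<in> L \<Longrightarrow> f2 w = 1"
  proof (rule Urysohn[of "K \<union> - \<Omega>" L 0 "1::real"])
    show "(K \<union> - \<Omega>) \<inter> L = {}" using K L B by auto
  qed (use cl in auto)
  define f where "f w = f1 w - f2 w" for w
  have fc: "continuous_on UNIV f" unfolding f_def by (intro continuous_intros f1 f2)
  have fC: "f \<in> C0 \<Omega>" using f1 f2 by (intro C0I[OF \<Omega>(2) fc]) (auto simp: f_def)
  have f01: "0 \<le> f1 w" "f1 w \<le> 1" "0 \<le> f2 w" "f2 w \<le> 1" for w
    using f1(2)[of w] f2(2)[of w] by (auto simp: closed_segment_eq_real_ivl)
  have bnd: "\<bar>f w\<bar> \<le> 1" for w using f01[of w] by (auto simp: f_def)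
  have int: "integrable Q (\<lambda>w. f w)" "integrable Q (\<lambda>w. indicator A w - indicator (\<Omega> - A) w :: real)"
    if "finite_measure Q" "sets Q = borel_sets \<Omega>" "A \<in> borel_sets \<Omega>" for Q A
  proof -
    interpret Q: finite_measure Q by fact
    show "integrable Q (\<lambda>w. f w)"
      using C0_measurable[OF \<Omega>(1) fC] that(2) bnd
      by (intro Q.integrable_const_bound[where B=1]) (auto cong: measurable_cong_sets)
    show "integrable Q (\<lambda>w. indicator A w - indicator (\<Omega> - A) w :: real)"
      using that \<Omega>m by (intro Bochner_Integration.integrable_diff) (auto simp: less_top[symmetric])
  qed
  have fK: "f w = 1" if "w \<in> K" for w using f1 f2 that by (auto simp: f_def)
  have fL: "f w = - 1" if "w \<in> L" for w using f1 f2 that by (auto simp: f_def)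
  have "(LINT w|pos_part \<Omega> \<mu>. indicator K w - indicator (\<Omega> - K) w) \<le> (LINT w|pos_part \<Omega> \<mu>. f w)"
    using KL bnd fK by (intro integral_mono int P.finite_measure_axioms) (auto simp: indicator_def abs_le_iff minus_le_iff)
  also have "(LINT w|pos_part \<Omega> \<mu>. indicator K w - indicator (\<Omega> - K) w) = ?P K - ?P (\<Omega> - K)"
    using KL \<Omega>m borel_sets_subset[OF KL(1)] by (subst Bochner_Integration.integral_diff) (auto simp: less_top[symmetric] Int_absorb2 Int_absorb1)
  also have "?P K = ?P \<Omega> - ?P (\<Omega> - K)"
    using KL \<Omega>m borel_sets_subset[OF KL(1)] by (subst P.finite_measure_Diff) auto
  finally have 1: "?P \<Omega> - 4 * d \<le> (LINT w|pos_part \<Omega> \<mu>. f w)" using PK by simp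
  have "(LINT w|neg_part \<Omega> \<mu>. f w) \<le> (LINT w|neg_part \<Omega> \<mu>. - (indicator L w - indicator (\<Omega> - L) w))"
    using KL bnd fL by (intro integral_mono int Bochner_Integration.integrable_minus N.finite_measure_axioms) (auto simp: indicator_def abs_le_iff)
  also have "\<dots> = - (?N L - ?N (\<Omega> - L))"
    unfolding Bochner_Integration.integral_minus
    using KL \<Omega>m borel_sets_subset[OF KL(2)] by (subst Bochner_Integration.integral_diff) (auto simp: less_top[symmetric] Int_absorb2 Int_absorb1)
  also have "?N L = ?N \<Omega> - ?N (\<Omega> - L)"
    using KL \<Omega>m borel_sets_subset[OF KL(2)] by (subst N.finite_measure_Diff) auto
  finally have 2: "(LINT w|neg_part \<Omega> \<mu>. f w) \<le> - ?N \<Omega> + 4 * d" using NL by simp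
  have "tv_norm \<Omega> \<mu> - e \<le> pairing \<Omega> f \<mu>"
    using 1 2 unfolding pairing_def tv_norm_def variation_def d_def by simp
  then show ?thesis using that fC bnd by blast
qed

lemma C0_uniform_limit:
  assumes "\<And>e. e > 0 \<Longrightarrow> \<exists>g\<in>C0 \<Omega>. \<forall>w\<in>\<Omega>. \<bar>f w - g w\<bar> \<le> e"
  shows "f \<in> C0 \<Omega>"
  unfolding C0_def
proof (intro CollectI allI impI)
  fix e :: real assume "e > 0"
  then obtain g where g: "g \<in> C0 \<Omega>" "\<forall>w\<in>\<Omega>. \<bar>f w - g w\<bar> \<le> e / 2" using assms[of "e / 2"] by auto
  then obtain k where k: "k \<in> Cc \<Omega>" "\<forall>w\<in>\<Omega>. \<bar>g w - k w\<bar> \<le> e / 2"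
    using \<open>e > 0\<close> unfolding C0_def by (auto dest: spec[of _ "e / 2"])
  have "\<bar>f w - k w\<bar> \<le> e" if "w \<in> \<Omega>" for w
    using bspec[OF g(2) that] bspec[OF k(2) that] by linarith
  then show "\<exists>g\<in>Cc \<Omega>. \<forall>w\<in>\<Omega>. \<bar>f w - g w\<bar> \<le> e" using k by blast
qed

text \<open>
  If \<open>\<bar>g\<bar> \<le> 1\<close> and \<open>\<langle>g, \<nu>\<rangle>\<close> is at least half the norm of \<open>\<nu>\<close>, then the pairings of \<open>f + r g\<close> and
  \<open>f - r g\<close> with \<open>\<nu>\<close> differ by at least \<open>r \<parallel>\<nu>\<parallel>\<close>, so one of them has at least half that size.
\<close>

lemma pairing_large_nearby:
  assumes \<Omega>: "open \<Omega>" "bounded \<Omega>" and \<nu>: "\<nu> \<in> signed_measures \<Omega>" and f: "f \<in> C0 \<Omega>" "\<forall>w. w \<notin> \<Omega> \<longrightarrow> f w = 0"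
    and r: "r > 0"
  shows "\<exists>f'. f' \<in> C0 \<Omega> \<and> (\<forall>w. w \<notin> \<Omega> \<longrightarrow> f' w = 0) \<and> (\<forall>w. \<bar>f' w - f w\<bar> \<le> r) \<and>
    r * tv_norm \<Omega> \<nu> / 2 \<le> \<bar>pairing \<Omega> f' \<nu>\<bar>"
proof -
  have "0 \<le> tv_norm \<Omega> \<nu>" by (simp add: tv_norm_def variation_def)
  then consider "tv_norm \<Omega> \<nu> = 0" | "tv_norm \<Omega> \<nu> > 0" by linarith
  then show ?thesis
  proof cases
    case 1 then show ?thesis using f r by (intro exI[of _ f]) simp
  next
    case 2
    obtain g where g: "g \<in> C0 \<Omega>" "\<And>w. \<bar>g w\<bar> \<le> 1" "tv_norm \<Omega> \<nu> - tv_norm \<Omega> \<nu> / 2 \<le> pairing \<Omega> g \<nu>"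
      using norming_C0_function[OF \<Omega> \<nu>, of "tv_norm \<Omega> \<nu> / 2"] 2 by auto
    obtain B where B: "\<And>w. w \<in> \<Omega> \<Longrightarrow> \<bar>f w\<bar> \<le> B" using C0_bounded[OF f(1)] by blast
    \<comment> \<open>Perturbations of \<open>f\<close> in the direction of \<open>g\<close>; \<open>c = r\<close> or \<open>c = - r\<close> will do.\<close>
    define F where "F c w = (if w \<in> \<Omega> then 1 * f w + c * g w else 0)" for c :: real and w
    have F: "F c \<in> C0 \<Omega>" for c unfolding F_def by (intro C0_linear \<Omega> f g)
    have pF: "pairing \<Omega> (F c) \<nu> = pairing \<Omega> f \<nu> + c * pairing \<Omega> g \<nu>" for c
      unfolding F_def using pairing_linear_function[OF C0_measurable[OF \<Omega>(1) f(1)] B C0_measurable[OF \<Omega>(1) g(1)] g(2) \<nu>, of 1 c] by simp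
    have "r * (tv_norm \<Omega> \<nu> / 2) \<le> r * pairing \<Omega> g \<nu>" using g(3) r by (intro mult_left_mono) auto
    then have large: "r * tv_norm \<Omega> \<nu> / 2 \<le> \<bar>pairing \<Omega> (F r) \<nu>\<bar> \<or> r * tv_norm \<Omega> \<nu> / 2 \<le> \<bar>pairing \<Omega> (F (- r)) \<nu>\<bar>"
    proof -
      have "x \<le> \<bar>p + r * q\<bar> \<or> x \<le> \<bar>p + - r * q\<bar>" if "x \<le> r * q" for x p q
        using that by (simp add: abs_if) linarith
      from this[of "r * tv_norm \<Omega> \<nu> / 2"] \<open>r * (tv_norm \<Omega> \<nu> / 2) \<le> _\<close> show ?thesis unfolding pF by simp
    qed
    have close: "\<bar>F c w - f w\<bar> \<le> r" if "\<bar>c\<bar> = r" for c w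
      using spec[OF f(2), of w] g(2)[of w] r that mult_left_mono[of "\<bar>g w\<bar>" 1 r] by (auto simp: F_def abs_mult)
    have off: "F c w = 0" if "w \<notin> \<Omega>" for c w using that by (simp add: F_def)
    have "\<exists>c. \<bar>c\<bar> = r \<and> r * tv_norm \<Omega> \<nu> / 2 \<le> \<bar>pairing \<Omega> (F c) \<nu>\<bar>"
      using r large by (metis abs_minus_cancel abs_of_pos)
    then obtain c where "\<bar>c\<bar> = r" "r * tv_norm \<Omega> \<nu> / 2 \<le> \<bar>pairing \<Omega> (F c) \<nu>\<bar>" by blast
    then show ?thesis using F close off by (intro exI[of _ "F c"]) simp
  qed
qed

text \<open>
  Sokal's proof of the uniform boundedness principle. Were the norms unbounded, one could pick
  measures of norm exceeding \<open>10\<^sup>n\<close> and functions \<open>F\<^sub>n\<close> with steps of size at most \<open>5\<^sup>-\<^sup>n\<close>, each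
  making the pairing with the \<open>n\<close>-th measure of order \<open>2\<^sup>n\<close>. The steps after the \<open>n\<close>-th
  add up to at most a quarter of \<open>5\<^sup>-\<^sup>n\<close> and cannot undo this, so the limit function violates
  pointwise boundedness.
\<close>

theorem uniform_boundedness_measures:
  fixes \<mu> :: "nat \<Rightarrow> 'a::euclidean_space set \<Rightarrow> real"
  assumes \<Omega>: "open \<Omega>" "bounded \<Omega>" and \<mu>: "\<And>k. \<mu> k \<in> signed_measures \<Omega>"
    and pw: "\<And>f. f \<in> C0 \<Omega> \<Longrightarrow> \<exists>c. \<forall>k. \<bar>pairing \<Omega> f (\<mu> k)\<bar> \<le> c"
  shows "\<exists>M. \<forall>k. tv_norm \<Omega> (\<mu> k) \<le> M"
proof (rule ccontr)
  assume "\<not> ?thesis"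
  then have "\<exists>k. tv_norm \<Omega> (\<mu> k) > 10 ^ n" for n :: nat by (meson not_le)
  then obtain \<kappa> where \<kappa>: "\<And>n. tv_norm \<Omega> (\<mu> (\<kappa> n)) > 10 ^ n" by metis
  let ?P = "\<lambda>f. f \<in> C0 \<Omega> \<and> (\<forall>w. w \<notin> \<Omega> \<longrightarrow> f w = (0::real))"
  let ?Q = "\<lambda>n f f'. (\<forall>w. \<bar>f' w - f w\<bar> \<le> (1/5) ^ n) \<and> (1/5) ^ n * tv_norm \<Omega> (\<mu> (\<kappa> n)) / 2 \<le> \<bar>pairing \<Omega> f' (\<mu> (\<kappa> n))\<bar>"
  have step: "\<exists>f'. ?P f' \<and> ?Q n f f'" if f: "?P f" for n f
  proof -
    have "(1/5::real) ^ n > 0" by simp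
    from pairing_large_nearby[OF \<Omega> \<mu>[of "\<kappa> n"] conjunct1[OF f] conjunct2[OF f] this] show ?thesis by blast
  qed
  have "?P (\<lambda>w. 0)" using \<Omega> by (auto intro!: C0I)
  then have "\<exists>F. \<forall>n. (?P (F n) \<and> (n = 0 \<longrightarrow> F n = (\<lambda>w. 0))) \<and> ?Q n (F n) (F (Suc n))"
    using step by (intro dependent_nat_choice) (blast, simp)
  then obtain F where F: "\<And>n. F n \<in> C0 \<Omega>" "F 0 = (\<lambda>w. 0)" "\<And>n w. \<bar>F (Suc n) w - F n w\<bar> \<le> (1/5) ^ n"
    "\<And>n. (1/5) ^ n * tv_norm \<Omega> (\<mu> (\<kappa> n)) / 2 \<le> \<bar>pairing \<Omega> (F (Suc n)) (\<mu> (\<kappa> n))\<bar>"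
    by blast
  have "summable (\<lambda>n. F (Suc n) w - F n w)" for w
    by (rule summable_comparison_test'[where g="\<lambda>n. (1/5) ^ n" and N=0]) (use F(3) in \<open>auto intro!: summable_geometric\<close>)
  then have lim: "(\<lambda>n. F n w) \<longlonglongrightarrow> (\<Sum>n. F (Suc n) w - F n w)" for w
    using summable_LIMSEQ[of "\<lambda>n. F (Suc n) w - F n w"] F(2) 
    by (simp add: sum_lessThan_telescope[of "\<lambda>n. F n w"])
  define f where "f w = (\<Sum>n. F (Suc n) w - F n w)" for w
  have dF: "\<bar>F (n + m) w - F n w\<bar> \<le> 5/4 * (1/5) ^ n - 5/4 * (1/5) ^ (n + m)" for n m w
  proof (induction m)
    case (Suc m)
    then show ?case using F(3)[of "n + m" w] by simp
  qed simp
  have fF: "\<bar>f w - F n w\<bar> \<le> 5/4 * (1/5) ^ n" for n w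
  proof (rule LIMSEQ_le_const2)
    show "(\<lambda>m. \<bar>F (n + m) w - F n w\<bar>) \<longlonglongrightarrow> \<bar>f w - F n w\<bar>"
      using LIMSEQ_ignore_initial_segment[OF lim[of w], of n]
      unfolding f_def by (intro tendsto_intros) (simp add: add.commute)
    have "\<bar>F (n + m) w - F n w\<bar> \<le> 5/4 * (1/5) ^ n" for m
      by (rule order_trans[OF dF]) simp
    then show "\<exists>N. \<forall>m\<ge>N. \<bar>F (n + m) w - F n w\<bar> \<le> 5/4 * (1/5) ^ n" by blast
  qed
  have fC: "f \<in> C0 \<Omega>"
  proof (rule C0_uniform_limit)
    fix e :: real assume "e > 0"
    then obtain n where "(1/5) ^ n < e / 2" using real_arch_pow_inv[of "e / 2" "1/5"] by auto
    then have "5/4 * (1/5) ^ n \<le> e" by (simp add: field_simps)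
    then show "\<exists>g\<in>C0 \<Omega>. \<forall>w\<in>\<Omega>. \<bar>f w - g w\<bar> \<le> e"
      using F(1)[of n] by (intro bexI[of _ "F n"] ballI order_trans[OF fF])
  qed
  obtain c where c: "\<And>k. \<bar>pairing \<Omega> f (\<mu> k)\<bar> \<le> c" using pw[OF fC] by blast
  obtain n where n: "c * 4 < 2 ^ n" using real_arch_pow[of 2 "c * 4"] by auto
  let ?T = "tv_norm \<Omega> (\<mu> (\<kappa> n))"
  obtain B where B: "\<And>w. w \<in> \<Omega> \<Longrightarrow> \<bar>f w\<bar> \<le> B" using C0_bounded[OF fC] by blast
  obtain C where C: "\<And>w. w \<in> \<Omega> \<Longrightarrow> \<bar>F (Suc n) w\<bar> \<le> C" using C0_bounded[OF F(1)] by blast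
  let ?d = "\<lambda>w. if w \<in> \<Omega> then 1 * f w + (-1) * F (Suc n) w else 0"
  have dC: "?d \<in> C0 \<Omega>" by (intro C0_linear \<Omega> fC F)
  have "\<bar>pairing \<Omega> ?d (\<mu> (\<kappa> n))\<bar> \<le> (5/4 * (1/5) ^ Suc n) * ?T"
    using fF[of _ "Suc n"] by (intro pairing_bound C0_measurable \<Omega> dC \<mu>) auto
  moreover have "pairing \<Omega> ?d (\<mu> (\<kappa> n)) = pairing \<Omega> f (\<mu> (\<kappa> n)) - pairing \<Omega> (F (Suc n)) (\<mu> (\<kappa> n))"
    using pairing_linear_function[OF C0_measurable[OF \<Omega>(1) fC] B C0_measurable[OF \<Omega>(1) F(1)] C \<mu>, of 1 "-1"] by simp
  ultimately have "\<bar>pairing \<Omega> (F (Suc n)) (\<mu> (\<kappa> n))\<bar> \<le> c + 1/4 * (1/5) ^ n * ?T"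
    using c[of "\<kappa> n"] by (simp add: abs_if split: if_splits)
  with F(4)[of n] have "(1/5) ^ n * ?T \<le> c * 4" by simp
  moreover have "(1/5) ^ n * 10 ^ n \<le> (1/5) ^ n * ?T" using \<kappa>[of n] by (intro mult_left_mono) auto
  moreover have "(1/5) ^ n * 10 ^ n = (2::real) ^ n" by (simp add: power_mult_distrib[symmetric])
  ultimately show False using n by simp
qed

lemma weak_star_conv_tv_bounded:
  assumes \<Omega>: "open \<Omega>" "bounded \<Omega>" and h: "weak_star_conv \<Omega> h h0"
  shows "\<exists>M. \<forall>k. tv_norm \<Omega> (h k) \<le> M"
proof (rule uniform_boundedness_measures[OF \<Omega>])
  show "h k \<in> signed_measures \<Omega>" for k using h by (auto simp: weak_star_conv_def radon_def)
next
  fix f assume "f \<in> C0 \<Omega>"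
  then have "Bseq (\<lambda>k. pairing \<Omega> f (h k))"
    using h by (intro convergent_imp_Bseq) (auto simp: weak_star_conv_def convergent_def)
  then show "\<exists>c. \<forall>k. \<bar>pairing \<Omega> f (h k)\<bar> \<le> c" by (auto simp: Bseq_def)
qed

lemma tv_norm_scale_le:
  assumes \<Omega>: "open \<Omega>" "bounded \<Omega>" and \<mu>: "\<mu> \<in> signed_measures \<Omega>"
  shows "tv_norm \<Omega> (\<lambda>A. c * \<mu> A) \<le> \<bar>c\<bar> * tv_norm \<Omega> \<mu>"
proof (rule field_le_epsilon)
  fix e :: real assume e: "e > 0"
  have c\<mu>: "(\<lambda>A. c * \<mu> A) \<in> signed_measures \<Omega>" using signed_measures_linear[OF \<mu> \<mu>, of c 0] by simp
  obtain f where f: "f \<in> C0 \<Omega>" "\<And>w. \<bar>f w\<bar> \<le> 1" "tv_norm \<Omega> (\<lambda>A. c * \<mu> A) - e \<le> pairing \<Omega> f (\<lambda>A. c * \<mu> A)"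
    using norming_C0_function[OF \<Omega> c\<mu> e] by blast
  have "pairing \<Omega> f (\<lambda>A. c * \<mu> A) = c * pairing \<Omega> f \<mu>"
    using pairing_linear[OF _ C0_measurable[OF \<Omega>(1) f(1)] f(2) \<mu> \<mu>, of c 0] \<Omega> by simp
  also have "\<dots> \<le> \<bar>c\<bar> * \<bar>pairing \<Omega> f \<mu>\<bar>" by (simp add: abs_mult[symmetric])
  also have "\<dots> \<le> \<bar>c\<bar> * (1 * tv_norm \<Omega> \<mu>)"
    by (intro mult_left_mono pairing_bound C0_measurable \<Omega> f \<mu>) auto
  finally show "tv_norm \<Omega> (\<lambda>A. c * \<mu> A) \<le> \<bar>c\<bar> * tv_norm \<Omega> \<mu> + e" using f(3) by simp
qed

lemma C0_separates_measures:
  assumes \<Omega>: "open \<Omega>" "bounded \<Omega>" and \<mu>: "\<mu> \<in> signed_measures \<Omega>" "\<mu> \<noteq> (\<lambda>A. 0)"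
  obtains f where "f \<in> C0 \<Omega>" "\<And>w. \<bar>f w\<bar> \<le> 1" "pairing \<Omega> f \<mu> > 0"
proof -
  interpret P: finite_measure "pos_part \<Omega> \<mu>" by (rule finite_pos_part[OF \<mu>(1)])
  interpret N: finite_measure "neg_part \<Omega> \<mu>" by (rule finite_neg_part[OF \<mu>(1)])
  obtain A where A: "\<mu> A \<noteq> 0" using \<mu>(2) by auto
  then have A': "A \<in> borel_sets \<Omega>" using \<mu>(1) by (auto simp: signed_measures_def)
  have "measure (pos_part \<Omega> \<mu>) A \<le> measure (pos_part \<Omega> \<mu>) \<Omega>" "measure (neg_part \<Omega> \<mu>) A \<le> measure (neg_part \<Omega> \<mu>) \<Omega>"
    using P.bounded_measure[of A] N.bounded_measure[of A] by auto
  moreover have "measure (pos_part \<Omega> \<mu>) A \<ge> 0" "measure (neg_part \<Omega> \<mu>) A \<ge> 0" by auto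
  ultimately have pos: "tv_norm \<Omega> \<mu> > 0"
    using A Jordan_decomposition[OF \<mu>(1) A'] unfolding tv_norm_def variation_def by linarith
  then obtain f where f: "f \<in> C0 \<Omega>" "\<And>w. \<bar>f w\<bar> \<le> 1" "tv_norm \<Omega> \<mu> - tv_norm \<Omega> \<mu> / 2 \<le> pairing \<Omega> f \<mu>"
    using norming_C0_function[OF \<Omega> \<mu>(1) half_gt_zero] by metis
  show ?thesis by (rule that[OF f(1,2)]) (use f(3) pos in linarith)
qed

section \<open>Weak sequential compactness of probability measures with bounded support\<close>

text \<open>
  Cover \<open>S\<close> for every \<open>n\<close> by finitely many balls of radius \<open>1 / (n + 1)\<close>, enumerate all these
  balls as \<open>B\<^sub>0, B\<^sub>1, \<dots>\<close>, and send \<open>x\<close> to the base-4 number whose \<open>m\<close>-th digit tells whether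
  \<open>x \<in> B\<^sub>m\<close>. Base 4 leaves gaps, as in the Cantor set, so nearby codes share their leading
  digits, that is, their points lie in a common small ball. The inverse of the code is therefore
  uniformly continuous and extends continuously to the whole line.
\<close>

lemma totally_bounded_coding:
  fixes S :: "'a::euclidean_space set"
  assumes "bounded S"
  obtains s :: "'a \<Rightarrow> real" and g :: "real \<Rightarrow> 'a" and R
  where "s \<in> borel_measurable borel" "\<And>x. 0 \<le> s x" "\<And>x. s x \<le> 2"
    "continuous_on UNIV g" "\<And>t. norm (g t) \<le> R" "\<And>x. x \<in> S \<Longrightarrow> g (s x) = x"
proof -
  obtain R where R: "R > 0" "S \<subseteq> cball 0 R" 
    using assms by (fastforce simp: bounded_pos)
  have "\<exists>F. finite F \<and> S \<subseteq> (\<Union>c\<in>F. ball c (1 / real (Suc n)))" for n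
  proof -
    have "compact (closure S)" using assms by (simp add: compact_closure)
    then obtain F where "finite F" "closure S \<subseteq> (\<Union>c\<in>F. ball c (1 / real (Suc n)))"
      unfolding compact_eq_totally_bounded by (metis divide_pos_pos of_nat_0_less_iff zero_less_Suc zero_less_one)
    then show ?thesis using closure_subset[of S] by blast
  qed
  then obtain F where F: "\<And>n. finite (F n)" "\<And>n. S \<subseteq> (\<Union>c\<in>F n. ball c (1 / real (Suc n)))" by metis
  define \<B> where "\<B> = insert {} (\<Union>n. (\<lambda>c. ball c (1 / real (Suc n))) ` F n)"
  have \<B>: "countable \<B>" "\<B> \<noteq> {}"
    unfolding \<B>_def using F(1) by (simp_all add: countable_finite)
  define B where "B = from_nat_into \<B>"
  have B_in: "B m \<in> \<B>" for m using from_nat_into[OF \<B>(2)] by (simp add: B_def)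
  have B_borel [measurable]: "B m \<in> sets borel" for m using B_in[of m] by (auto simp: \<B>_def)
  have B_surj: "\<exists>m. B m = U" if "U \<in> \<B>" for U using from_nat_into_surj[OF \<B>(1) that] by (simp add: B_def)
  define s :: "'a \<Rightarrow> real" where "s x = (\<Sum>m. indicator (B m) x * (1/4) ^ m)" for x
  have sm: "summable (\<lambda>m. indicator (B m) x * (1/4) ^ m :: real)" for x
    by (rule summable_comparison_test'[where g="\<lambda>m. (1/4) ^ m" and N=0]) (auto simp: indicator_def intro!: summable_geometric)
  have s_meas: "s \<in> borel_measurable borel" unfolding s_def by measurable
  have s0: "0 \<le> s x" for x unfolding s_def by (intro suminf_nonneg sm) auto
  have s2: "s x \<le> 2" for x
  proof -
    have "s x \<le> (\<Sum>m. (1/4) ^ m)"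
      unfolding s_def by (intro suminf_le sm summable_geometric) (auto simp: indicator_def)
    also have "\<dots> \<le> 2" by (subst suminf_geometric) auto
    finally show ?thesis .
  qed
  \<comment> \<open>At the first differing index \<open>k\<close> the codes differ by \<open>4\<^sup>-\<^sup>k\<close> up to a tail of at most \<open>4\<^sup>-\<^sup>k / 3\<close>.\<close>
  have agree: "x \<in> B m \<longleftrightarrow> y \<in> B m" if close: "\<bar>s x - s y\<bar> < 1/2 * (1/4) ^ M" and "m \<le> M" for x y m M
  proof (rule ccontr)
    assume "\<not> (x \<in> B m \<longleftrightarrow> y \<in> B m)"
    then obtain k where k: "\<not> (x \<in> B k \<longleftrightarrow> y \<in> B k)" "k \<le> m" "\<And>i. i < k \<Longrightarrow> (x \<in> B i \<longleftrightarrow> y \<in> B i)"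
      using exists_least_iff[of "\<lambda>m. \<not> (x \<in> B m \<longleftrightarrow> y \<in> B m)"] by (metis not_le)
    define a :: "nat \<Rightarrow> real" where "a i = (indicator (B i) x - indicator (B i) y) * (1/4) ^ i" for i
    have suma: "summable a" and sa: "s x - s y = (\<Sum>i. a i)"
      using summable_diff[OF sm[of x] sm[of y]] suminf_diff[OF sm[of x] sm[of y]]
      unfolding a_def s_def left_diff_distrib by simp_all
    have a_le: "\<bar>a i\<bar> \<le> (1/4) ^ i" for i by (auto simp: a_def indicator_def)
    have "(\<Sum>i<Suc k. a i) = a k" using k(3) by (simp add: a_def indicator_def)
    then have split: "s x - s y = (\<Sum>i. a (i + Suc k)) + a k"
      using suminf_split_initial_segment[OF suma, of "Suc k"] sa by simp
    have gs: "summable (\<lambda>i. (1/4::real) ^ (i + Suc k))" by (intro summable_ignore_initial_segment summable_geometric) simp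
    have "\<bar>\<Sum>i. a (i + Suc k)\<bar> \<le> (\<Sum>i. \<bar>a (i + Suc k)\<bar>)"
      by (intro summable_rabs summable_comparison_test'[OF gs, of 0]) (simp add: a_le del: power_Suc add_Suc_right)
    also have "\<dots> \<le> (\<Sum>i. (1/4) ^ (i + Suc k))"
      by (intro suminf_le summable_comparison_test'[OF gs, of 0] gs) (simp_all add: a_le del: power_Suc add_Suc_right)
    also have "\<dots> = (\<Sum>i. (1/4) ^ i * (1/4) ^ Suc k)" by (simp add: power_add)
    also have "\<dots> = (\<Sum>i. (1/4) ^ i) * (1/4) ^ Suc k"
      by (intro suminf_mult2[symmetric] summable_geometric) simp
    also have "(\<Sum>i. (1/4::real) ^ i) = 4/3" by (subst suminf_geometric) auto
    finally have tail: "\<bar>\<Sum>i. a (i + Suc k)\<bar> \<le> 1/3 * (1/4) ^ k" by simp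
    have "\<bar>a k\<bar> = (1/4) ^ k" using k(1) by (auto simp: a_def indicator_def)
    with split tail have "2/3 * (1/4) ^ k \<le> \<bar>s x - s y\<bar>" by linarith
    moreover have "(1/4::real) ^ M \<le> (1/4) ^ k" using k(2) \<open>m \<le> M\<close> by (intro power_decreasing) auto
    moreover have "(1/4::real) ^ k > 0" by simp
    ultimately show False using close by linarith
  qed
  have uc: "\<exists>\<delta>>0. \<forall>x\<in>S. \<forall>y\<in>S. \<bar>s x - s y\<bar> < \<delta> \<longrightarrow> dist x y < e" if e: "e > 0" for e :: real
  proof -
    obtain n where n: "inverse (real (Suc n)) < e / 2" using reals_Archimedean[of "e / 2"] e by auto
    have "\<forall>c\<in>F n. \<exists>m. B m = ball c (1 / real (Suc n))" by (intro ballI B_surj) (auto simp: \<B>_def)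
    then obtain idx where idx: "\<And>c. c \<in> F n \<Longrightarrow> B (idx c) = ball c (1 / real (Suc n))" by metis
    define M where "M = Max (insert 0 (idx ` F n))"
    have M: "idx c \<le> M" if "c \<in> F n" for c unfolding M_def using that F(1) by (intro Max_ge) auto
    show ?thesis
    proof (intro exI[of _ "1/2 * (1/4) ^ M"] conjI ballI impI)
      fix x y assume xy: "x \<in> S" "y \<in> S" "\<bar>s x - s y\<bar> < 1/2 * (1/4) ^ M"
      obtain c where c: "c \<in> F n" "x \<in> ball c (1 / real (Suc n))" using F(2)[of n] xy(1) by blast
      then have "x \<in> B (idx c)" by (simp add: idx)
      then have "y \<in> ball c (1 / real (Suc n))" using agree[OF xy(3) M[OF c(1)]] by (simp add: idx c(1))
      then show "dist x y < e"
        using c n dist_triangle[of x y c] by (simp add: dist_commute inverse_eq_divide)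
    qed simp
  qed
  have inj: "inj_on s S"
  proof (rule inj_onI, rule ccontr)
    fix x y assume xy: "x \<in> S" "y \<in> S" "s x = s y" "x \<noteq> y"
    then show False using uc[of "dist x y"] by force
  qed
  define t where "t = inv_into S s"
  have ts: "t (s x) = x" if "x \<in> S" for x using inj that by (simp add: t_def)
  have "uniformly_continuous_on (s ` S) t"
    unfolding uniformly_continuous_on_def
  proof (intro allI impI)
    fix e :: real assume "e > 0"
    from uc[OF this] obtain \<delta> where "\<delta> > 0" "\<And>x y. x \<in> S \<Longrightarrow> y \<in> S \<Longrightarrow> \<bar>s x - s y\<bar> < \<delta> \<Longrightarrow> dist x y < e" by blast
    then show "\<exists>d>0. \<forall>x\<in>s ` S. \<forall>x'\<in>s ` S. dist x' x < d \<longrightarrow> dist (t x') (t x) < e"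
      by (intro exI[of _ \<delta>]) (auto simp: ts dist_real_def)
  qed
  then obtain t' where t': "uniformly_continuous_on (closure (s ` S)) t'" "\<And>u. u \<in> s ` S \<Longrightarrow> t u = t' u"
    using uniformly_continuous_on_extension_on_closure[of "s ` S" t] by metis
  have c': "continuous_on (closure (s ` S)) t'" using t'(1) by (rule uniformly_continuous_imp_continuous)
  have "t' ` (s ` S) \<subseteq> cball 0 R" using t'(2) ts R by fastforce
  then have "t' ` closure (s ` S) \<subseteq> cball 0 R" by (intro image_closure_subset c') auto
  then obtain g where g: "continuous_on UNIV g" "g ` UNIV \<subseteq> cball 0 R" "\<And>u. u \<in> closure (s ` S) \<Longrightarrow> g u = t' u"
    using Dugundji[of "cball (0::'a) R" UNIV "closure (s ` S)" t'] c' R by auto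
  show ?thesis
  proof (rule that[OF s_meas s0 s2 g(1)])
    show "norm (g t) \<le> R" for t using g(2) by (simp add: image_subset_iff)
    show "g (s x) = x" if "x \<in> S" for x
      using g(3)[of "s x"] t'(2)[of "s x"] ts[OF that] that closure_subset[of "s ` S"] by auto
  qed
qed

text \<open>
  The image measures under the code live on a bounded interval, hence are tight, and Helly's
  theorem provides a weakly convergent subsequence. The continuous left inverse \<open>g\<close> carries its
  limit back: \<open>f \<circ> g\<close> is bounded and continuous whenever \<open>f\<close> is continuous.
\<close>

theorem bounded_support_weak_subsequence:
  fixes N :: "nat \<Rightarrow> 'a::euclidean_space measure"
  assumes N: "\<And>k. prob_space (N k)" "\<And>k. sets (N k) = sets borel"
    and S: "bounded S" "\<And>k. AE x in N k. x \<in> S"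
  shows "\<exists>(r :: nat \<Rightarrow> nat) \<nu>. strict_mono r \<and> prob_space \<nu> \<and> sets \<nu> = sets borel \<and>
    (\<forall>f :: 'a \<Rightarrow> real. continuous_on UNIV f \<longrightarrow> (\<lambda>k. LINT x|N (r k). f x) \<longlonglongrightarrow> (LINT x|\<nu>. f x))"
proof -
  obtain s :: "'a \<Rightarrow> real" and g :: "real \<Rightarrow> 'a" and R where
    s [measurable]: "s \<in> borel_measurable borel" and s02: "\<And>x. 0 \<le> s x" "\<And>x. s x \<le> 2"
    and g: "continuous_on UNIV g" "\<And>t. norm (g t) \<le> R" "\<And>x. x \<in> S \<Longrightarrow> g (s x) = x"
    using totally_bounded_coding[OF S(1)] by metis
  have gm [measurable]: "g \<in> borel_measurable borel" using g(1) by (rule borel_measurable_continuous_onI)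
  define D where "D k = distr (N k) borel s" for k
  have sN [measurable]: "s \<in> borel_measurable (N k)" for k using s N(2) by (simp cong: measurable_cong_sets)
  have D: "real_distribution (D k)" for k
    unfolding D_def by (rule prob_space.real_distribution_distr[OF N(1) sN])
  have "measure (D k) {-1<..2} = 1" for k
  proof -
    have "s -` {-1<..2} \<inter> space (N k) = space (N k)" using s02 less_le_trans[of "-1" 0 "s x" for x] by auto
    then show ?thesis unfolding D_def by (subst measure_distr) (auto simp: prob_space.prob_space[OF N(1)])
  qed
  then have "tight D"
    unfolding tight_def using D by (intro conjI allI impI exI[of _ "-1"] exI[of _ 2]) auto
  from tight_imp_convergent_subsubsequence[OF this strict_mono_id]
  obtain r M where r: "strict_mono r" and M: "real_distribution M" and wc: "weak_conv_m (D \<circ> r) M"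
    by auto
  interpret M: real_distribution M by fact
  have gM: "g \<in> borel_measurable M" by simp
  show ?thesis
  proof (intro exI[of _ r] exI[of _ "distr M borel g"] conjI allI impI)
    show "strict_mono r" by (rule r)
    show "prob_space (distr M borel g)" by (rule M.prob_space_distr[OF gM])
    show "sets (distr M borel g) = sets borel" by simp
  next
    fix f :: "'a \<Rightarrow> real" assume f: "continuous_on UNIV f"
    have fm [measurable]: "f \<in> borel_measurable borel" using f by (rule borel_measurable_continuous_onI)
    have "bounded (f ` cball 0 R)"
      by (intro compact_imp_bounded compact_continuous_image continuous_on_subset[OF f]) auto
    then obtain C where C: "\<And>x. norm x \<le> R \<Longrightarrow> \<bar>f x\<bar> \<le> C"
      by (fastforce simp: bounded_iff)
    have cont: "continuous_on UNIV (\<lambda>t. f (g t))"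
      by (rule continuous_on_compose2[OF f g(1)]) auto
    have "(\<lambda>k. LINT t|(D \<circ> r) k. f (g t)) \<longlonglongrightarrow> (LINT t|M. f (g t))"
      using C g(2) D by (intro weak_conv_imp_integral_bdd_continuous_conv[OF _ M wc, where B=C])
        (auto simp: continuous_on_eq_continuous_at[OF open_UNIV] intro: continuous_on_eq_continuous_at[OF open_UNIV, THEN iffD1, OF cont, rule_format])
    moreover have "(LINT t|(D \<circ> r) k. f (g t)) = (LINT x|N (r k). f x)" for k
    proof -
      have "(LINT t|(D \<circ> r) k. f (g t)) = (LINT x|N (r k). f (g (s x)))"
        unfolding D_def o_def by (subst integral_distr[OF sN]) auto
      also have "\<dots> = (LINT x|N (r k). f x)"
        using S(2)[of "r k"] N(2)[of "r k"] g(3)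
        by (intro integral_cong_AE) (auto cong: measurable_cong_sets)
      finally show ?thesis .
    qed
    moreover have "(LINT t|M. f (g t)) = (LINT x|distr M borel g. f x)"
      by (subst integral_distr[OF gM]) auto
    ultimately show "(\<lambda>k. LINT x|N (r k). f x) \<longlonglongrightarrow> (LINT x|distr M borel g. f x)" by simp
  qed
qed

section \<open>Measures with a Lebesgue density\<close>

lemma ident_borel_lebesgue_on: "(\<lambda>w. w) \<in> borel_measurable (lebesgue_on (\<Omega> :: 'a::euclidean_space set))"
  by (intro measurable_restrict_space1 measurable_completion) simp

lemma embed_L1_eq_weighted_image:
  fixes \<Omega> :: "'a::euclidean_space set"
  assumes \<Omega>: "\<Omega> \<in> sets borel"
  shows "embed_L1 \<Omega> v = weighted_image \<Omega> (lebesgue_on \<Omega>) (\<lambda>w. w) v"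
proof
  fix A
  have "(LINT w:A|lebesgue. v w) = (LINT w|lebesgue_on \<Omega>. indicator A w * v w)" if "A \<subseteq> \<Omega>"
  proof -
    have eq: "(\<lambda>w. indicator A w *\<^sub>R v w) = (\<lambda>w. indicator \<Omega> w *\<^sub>R (indicator A w * v w))"
      using that by (auto simp: indicator_def fun_eq_iff)
    show ?thesis
      unfolding set_lebesgue_integral_def eq using \<Omega> by (intro integral_restrict_space[symmetric]) auto
  qed
  then show "embed_L1 \<Omega> v A = weighted_image \<Omega> (lebesgue_on \<Omega>) (\<lambda>w. w) v A"
    using borel_sets_subset[of A \<Omega>] by (simp add: embed_L1_def weighted_image_def)
qed

lemma embed_L1_signed:
  "\<Omega> \<in> sets borel \<Longrightarrow> integrable (lebesgue_on \<Omega>) v \<Longrightarrow> embed_L1 \<Omega> v \<in> signed_measures \<Omega>"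
  by (simp add: embed_L1_eq_weighted_image weighted_image_signed ident_borel_lebesgue_on)

lemma pairing_embed_L1:
  assumes \<Omega>: "open \<Omega>" and f: "f \<in> C0 \<Omega>" and v: "integrable (lebesgue_on \<Omega>) v"
  shows "pairing \<Omega> f (embed_L1 \<Omega> v) = (LINT w|lebesgue_on \<Omega>. f w * v w)"
proof -
  obtain B where B: "\<And>w. w \<in> \<Omega> \<Longrightarrow> \<bar>f w\<bar> \<le> B" using C0_bounded[OF f] by blast
  have "pairing \<Omega> f (embed_L1 \<Omega> v) = (LINT w|lebesgue_on \<Omega>. indicator \<Omega> w * f w * v w)"
    unfolding embed_L1_eq_weighted_image[OF borel_open[OF \<Omega>]]
    using \<Omega> v by (intro pairing_weighted_image[OF borel_open[OF \<Omega>] C0_measurable[OF \<Omega> f] B] ident_borel_lebesgue_on)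
  also have "\<dots> = (LINT w|lebesgue_on \<Omega>. f w * v w)"
    by (intro Bochner_Integration.integral_cong) (auto simp: space_restrict_space)
  finally show ?thesis .
qed

lemma integrable_indicator_lebesgue_on:
  fixes \<Omega> :: "'a::euclidean_space set" and v :: "'a \<Rightarrow> real"
  assumes "integrable (lebesgue_on \<Omega>) v" "A \<in> sets borel"
  shows "integrable (lebesgue_on \<Omega>) (\<lambda>w. indicator A w * v w)"
  using integrable_indicator_mult[OF assms(1) ident_borel_lebesgue_on assms(2)] .

lemma embed_L1_linear:
  assumes \<Omega>: "\<Omega> \<in> sets borel" and "integrable (lebesgue_on \<Omega>) v" "integrable (lebesgue_on \<Omega>) u"
  shows "embed_L1 \<Omega> (\<lambda>w. a * v w + b * u w) = (\<lambda>A. a * embed_L1 \<Omega> v A + b * embed_L1 \<Omega> u A)"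
proof
  fix A
  show "embed_L1 \<Omega> (\<lambda>w. a * v w + b * u w) A = a * embed_L1 \<Omega> v A + b * embed_L1 \<Omega> u A"
  proof (cases "A \<in> borel_sets \<Omega>")
    case True
    have A: "A \<in> sets borel" by (rule borel_sets_borel[OF \<Omega> True])
    have "(\<lambda>w. indicator A w * (a * v w + b * u w)) = (\<lambda>w. a * (indicator A w * v w) + b * (indicator A w * u w))"
      by (simp add: algebra_simps)
    then show ?thesis
      using True integrable_indicator_lebesgue_on[OF assms(2) A] integrable_indicator_lebesgue_on[OF assms(3) A]
      by (simp add: embed_L1_eq_weighted_image[OF \<Omega>] weighted_image_def)
  qed (simp add: embed_L1_def)
qed

text \<open>
  The total variation is a supremum over Borel sets, while the density is only Lebesgue
  measurable. The set where it is nonnegative is therefore replaced by that of a Borel function which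
  agrees with the density almost everywhere.
\<close>

lemma L1_norm_le_tv_norm:
  fixes \<Omega> :: "'a::euclidean_space set"
  assumes \<Omega>: "\<Omega> \<in> sets borel" and v: "integrable (lebesgue_on \<Omega>) v"
  shows "L1_norm \<Omega> v \<le> tv_norm \<Omega> (embed_L1 \<Omega> v)"
proof -
  let ?\<mu> = "embed_L1 \<Omega> v"
  have \<mu>: "?\<mu> \<in> signed_measures \<Omega>" by (rule embed_L1_signed[OF \<Omega> v])
  have \<Omega>m: "\<Omega> \<in> borel_sets \<Omega>" using \<Omega> by (auto simp: sets_restrict_space_iff)
  have "v \<in> borel_measurable (lebesgue_on \<Omega>)" using v by auto
  then have "(\<lambda>w. indicator \<Omega> w *\<^sub>R v w) \<in> borel_measurable lebesgue"
    using \<Omega> by (subst (asm) borel_measurable_restrict_space_iff) auto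
  then obtain g where g: "g \<in> borel_measurable lborel" "AE w in lborel. indicator \<Omega> w *\<^sub>R v w = g w"
    using completion_ex_borel_measurable_real by blast
  then have gm: "g \<in> borel_measurable borel" by simp
  have "AE w in lebesgue. indicator \<Omega> w *\<^sub>R v w = g w" using g(2) by (rule AE_completion)
  then have AEg: "AE w in lebesgue_on \<Omega>. v w = g w"
    using \<Omega> by (subst AE_restrict_space_iff) (auto elim!: eventually_mono)
  define B where "B = \<Omega> \<inter> {w. g w \<ge> 0}"
  have "{w \<in> space borel. g w \<ge> 0} \<in> sets borel" using gm by measurable
  then have Bb: "B \<in> sets borel" using \<Omega> by (simp add: B_def)
  have B: "B \<in> borel_sets \<Omega>" "\<Omega> - B \<in> borel_sets \<Omega>"
    using Bb \<Omega> by (auto simp: sets_restrict_space_iff B_def)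
  have Cb: "\<Omega> - B \<in> sets borel" using Bb \<Omega> by auto
  note i1 = integrable_indicator_lebesgue_on[OF v Bb] and i2 = integrable_indicator_lebesgue_on[OF v Cb]
  have "L1_norm \<Omega> v = (LINT w|lebesgue_on \<Omega>. indicator B w * v w - indicator (\<Omega> - B) w * v w)"
    unfolding L1_norm_def
  proof (rule integral_cong_AE)
    show "AE w in lebesgue_on \<Omega>. \<bar>v w\<bar> = indicator B w * v w - indicator (\<Omega> - B) w * v w"
      using AEg AE_space by eventually_elim (auto simp: B_def indicator_def space_restrict_space)
  qed (use v i1 i2 in auto)
  also have "\<dots> = ?\<mu> B - ?\<mu> (\<Omega> - B)"
    using B i1 i2 by (simp add: embed_L1_eq_weighted_image[OF \<Omega>] weighted_image_def)
  finally have "L1_norm \<Omega> v = ?\<mu> B - ?\<mu> (\<Omega> - B)" .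
  moreover have "?\<mu> B \<le> measure (pos_part \<Omega> ?\<mu>) \<Omega>"
    using B \<Omega>m by (intro measure_pos_part_upper[OF \<mu>]) (auto simp: B_def)
  moreover have "- ?\<mu> (\<Omega> - B) \<le> measure (neg_part \<Omega> ?\<mu>) \<Omega>"
    unfolding neg_part_def
    using B \<Omega>m by (intro measure_pos_part_upper[OF signed_measures_uminus[OF \<mu>]]) auto
  ultimately show ?thesis by (simp add: tv_norm_def variation_def)
qed

section \<open>Weak-star sequential compactness\<close>

text \<open>
  Signs are handled by an additional coordinate: the density \<open>\<bar>v\<^sub>k\<bar>\<close> is pushed forward along
  \<open>w \<mapsto> (w, sgn (v\<^sub>k w))\<close> to a probability measure on a bounded subset of a product space. The
  pairing with \<open>f\<close> becomes the integral of the continuous function \<open>(w, \<sigma>) \<mapsto> f w \<sigma>\<close>, so weak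
  compactness of probability measures applies. Mass of the limit on the boundary of \<open>\<Omega>\<close> is dropped,
  which is harmless since functions in \<open>C\<^sub>0\<close> vanish there.
\<close>

theorem weak_star_subsequence:
  fixes \<Omega> :: "'a::euclidean_space set" and v :: "nat \<Rightarrow> 'a \<Rightarrow> real"
  assumes \<Omega>: "open \<Omega>" "bounded \<Omega>" and v: "\<And>k. integrable (lebesgue_on \<Omega>) (v k)" "\<And>k. L1_norm \<Omega> (v k) = 1"
  obtains r h where "strict_mono r" "weak_star_conv \<Omega> (\<lambda>k. embed_L1 \<Omega> (v (r k))) h"
proof -
  let ?L = "lebesgue_on \<Omega>"
  have \<Omega>b: "\<Omega> \<in> sets borel" using \<Omega> by auto
  have vm [measurable]: "v k \<in> borel_measurable ?L" for k using v(1)[of k] by auto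
  have [measurable]: "(\<lambda>w. w) \<in> borel_measurable ?L" by (rule ident_borel_lebesgue_on)
  define N where "N k = distr (density ?L (\<lambda>w. ennreal \<bar>v k w\<bar>)) borel (\<lambda>w. (w, sgn (v k w)))" for k
  have sg [measurable]: "(\<lambda>w. (w, sgn (v k w))) \<in> borel_measurable ?L" for k
    by (intro borel_measurable_Pair) auto
  have sgd: "(\<lambda>w. (w, sgn (v k w))) \<in> borel_measurable (density ?L (\<lambda>w. ennreal \<bar>v k w\<bar>))" for k
    using sg by simp
  have "prob_space (density ?L (\<lambda>w. ennreal \<bar>v k w\<bar>))" for k
  proof
    have "emeasure (density ?L (\<lambda>w. ennreal \<bar>v k w\<bar>)) (space ?L) = (\<integral>\<^sup>+ w. ennreal \<bar>v k w\<bar> \<partial>?L)"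
      by (subst emeasure_density) (auto intro!: nn_integral_cong)
    also have "\<dots> = ennreal (LINT w|?L. \<bar>v k w\<bar>)" using v(1) by (intro nn_integral_eq_integral) auto
    finally show "emeasure (density ?L (\<lambda>w. ennreal \<bar>v k w\<bar>)) (space (density ?L (\<lambda>w. ennreal \<bar>v k w\<bar>))) = 1"
      using v(2)[of k] by (simp add: L1_norm_def)
  qed
  then have N: "prob_space (N k)" for k unfolding N_def by (rule prob_space.prob_space_distr[OF _ sgd])
  have sN: "sets (N k) = sets borel" for k by (simp add: N_def)
  have bS: "bounded (\<Omega> \<times> {-1..1::real})" using \<Omega> by (intro bounded_Times) auto
  have Sb: "\<Omega> \<times> {-1..1::real} \<in> sets borel"
    using \<Omega>b by (subst borel_prod[symmetric]) auto
  have "AE z in N k. z \<in> \<Omega> \<times> {-1..1}" for k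
  proof -
    have "{z \<in> space borel. z \<in> \<Omega> \<times> {-1..1::real}} \<in> sets borel" using Sb by simp
    then show ?thesis unfolding N_def
      by (subst AE_distr_iff[OF sgd]) (auto simp: space_restrict_space sgn_if)
  qed
  then obtain r \<nu> where r: "strict_mono r" and \<nu>: "prob_space \<nu>" "sets \<nu> = sets borel"
    and lim: "\<And>f :: 'a \<times> real \<Rightarrow> real. continuous_on UNIV f \<Longrightarrow> (\<lambda>k. LINT z|N (r k). f z) \<longlonglongrightarrow> (LINT z|\<nu>. f z)"
    using bounded_support_weak_subsequence[of N "\<Omega> \<times> {-1..1}", OF N sN bS] by blast
  interpret \<nu>: prob_space \<nu> by fact
  \<comment> \<open>The sign coordinate, clamped so that it is integrable for every probability measure.\<close>
  define g :: "'a \<times> real \<Rightarrow> real" where "g z = max (-1) (min 1 (snd z))" for z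
  have gc: "continuous_on UNIV g" unfolding g_def by (intro continuous_intros)
  have fst: "fst \<in> borel_measurable \<nu>" 
    using \<nu>(2) borel_measurable_continuous_onI[of "fst :: 'a \<times> real \<Rightarrow> 'a"] by (simp add: continuous_on_fst cong: measurable_cong_sets)
  have gi: "integrable \<nu> g"
    using \<nu>(2) borel_measurable_continuous_onI[OF gc]
    by (intro \<nu>.integrable_const_bound[where B=1]) (auto simp: g_def cong: measurable_cong_sets)
  define h where "h = weighted_image \<Omega> \<nu> fst g"
  have hs: "h \<in> signed_measures \<Omega>" unfolding h_def by (rule weighted_image_signed[OF \<Omega>b fst gi])
  have "(\<lambda>k. pairing \<Omega> f (embed_L1 \<Omega> (v (r k)))) \<longlonglongrightarrow> pairing \<Omega> f h" if f: "f \<in> C0 \<Omega>" for f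
  proof -
    define F where "F w = (if w \<in> \<Omega> then f w else 0)" for w
    have Fc: "continuous_on UNIV F" unfolding F_def by (rule C0_extension_continuous[OF \<Omega>(1) f])
    have FGc: "continuous_on UNIV (\<lambda>z. F (fst z) * g z)"
      by (intro continuous_intros gc continuous_on_compose2[OF Fc]) auto
    have FGm: "(\<lambda>z. F (fst z) * g z) \<in> borel_measurable borel" by (rule borel_measurable_continuous_onI[OF FGc])
    obtain B where B: "\<And>w. w \<in> \<Omega> \<Longrightarrow> \<bar>f w\<bar> \<le> B" using C0_bounded[OF f] by blast
    have "(LINT z|N k. F (fst z) * g z) = pairing \<Omega> f (embed_L1 \<Omega> (v k))" for k
    proof -
      have Fg: "(\<lambda>w. F w * g (w, sgn (v k w))) \<in> borel_measurable ?L"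
        using measurable_compose[OF sg FGm, of k] by simp
      have "(LINT z|N k. F (fst z) * g z) = (LINT w|density ?L (\<lambda>w. ennreal \<bar>v k w\<bar>). F w * g (w, sgn (v k w)))"
        unfolding N_def by (subst integral_distr[OF sgd FGm]) simp
      also have "\<dots> = (LINT w|?L. \<bar>v k w\<bar> *\<^sub>R (F w * g (w, sgn (v k w))))"
        using Fg by (intro integral_density) auto
      also have "\<dots> = (LINT w|?L. f w * v k w)"
        by (intro Bochner_Integration.integral_cong) (auto simp: F_def g_def space_restrict_space sgn_if)
      also have "\<dots> = pairing \<Omega> f (embed_L1 \<Omega> (v k))" by (rule pairing_embed_L1[OF \<Omega>(1) f v(1), symmetric])
      finally show ?thesis .
    qed
    moreover have "(LINT z|\<nu>. F (fst z) * g z) = pairing \<Omega> f h"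
    proof -
      have "pairing \<Omega> f h = (LINT z|\<nu>. indicator \<Omega> (fst z) * f (fst z) * g z)"
        unfolding h_def by (rule pairing_weighted_image[OF \<Omega>b C0_measurable[OF \<Omega>(1) f] B fst gi])
      also have "\<dots> = (LINT z|\<nu>. F (fst z) * g z)"
        by (intro Bochner_Integration.integral_cong) (auto simp: F_def)
      finally show ?thesis by simp
    qed
    ultimately show ?thesis using lim[OF FGc] by simp
  qed
  then have "weak_star_conv \<Omega> (\<lambda>k. embed_L1 \<Omega> (v (r k))) h"
    unfolding weak_star_conv_def radon_eq_signed_measures[OF \<Omega>b]
    using hs embed_L1_signed[OF \<Omega>b v(1)] by auto
  with r show ?thesis by (rule that)
qed

section \<open>Normal directions at the box constraint\<close>

lemma finite_measure_lebesgue_on_bounded: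
  "open \<Omega> \<Longrightarrow> bounded \<Omega> \<Longrightarrow> finite_measure (lebesgue_on (\<Omega> :: 'a::euclidean_space set))"
  by (intro finite_measure_lebesgue_on bounded_set_imp_lmeasurable) auto

lemma Linf_ball_integrable:
  assumes "open \<Omega>" "bounded \<Omega>" "x \<in> Linf_ball \<Omega>"
  shows "integrable (lebesgue_on \<Omega>) x"
proof -
  interpret finite_measure "lebesgue_on \<Omega>" by (rule finite_measure_lebesgue_on_bounded[OF assms(1,2)])
  have "AE w in lebesgue_on \<Omega>. - 1 \<le> x w \<and> x w \<le> 1" using assms(3) by (simp add: Linf_ball_def)
  then have "AE w in lebesgue_on \<Omega>. norm (x w) \<le> 1" by eventually_elim auto
  then show ?thesis using assms(3) by (intro integrable_const_bound) (auto simp: Linf_ball_def)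
qed

lemma embed_L1_diff:
  assumes \<Omega>: "open \<Omega>" "bounded \<Omega>" and "x \<in> Linf_ball \<Omega>" "y \<in> Linf_ball \<Omega>"
  shows "embed_L1 \<Omega> (\<lambda>w. x w - y w) A = embed_L1 \<Omega> x A - embed_L1 \<Omega> y A"
  using fun_cong[OF embed_L1_linear[OF borel_open[OF \<Omega>(1)] Linf_ball_integrable[OF \<Omega> assms(3)] Linf_ball_integrable[OF \<Omega> assms(4)], of 1 "-1"], of A]
  by simp

lemma Linf_ball_convex_combination:
  assumes "x \<in> Linf_ball \<Omega>" "y \<in> Linf_ball \<Omega>" "0 \<le> t" "t \<le> 1"
  shows "(\<lambda>w. (1 - t) * x w + t * y w) \<in> Linf_ball \<Omega>"
proof -
  have x: "x \<in> borel_measurable (lebesgue_on \<Omega>)" "AE w in lebesgue_on \<Omega>. - 1 \<le> x w \<and> x w \<le> 1"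
    and y: "y \<in> borel_measurable (lebesgue_on \<Omega>)" "AE w in lebesgue_on \<Omega>. - 1 \<le> y w \<and> y w \<le> 1"
    using assms by (auto simp: Linf_ball_def)
  have "AE w in lebesgue_on \<Omega>. - 1 \<le> (1 - t) * x w + t * y w \<and> (1 - t) * x w + t * y w \<le> 1"
    using x(2) y(2)
  proof eventually_elim
    case (elim w)
    have "(1 - t) * x w + t * y w \<le> (1 - t) * 1 + t * 1"
      using elim assms by (intro add_mono mult_left_mono) auto
    moreover have "(1 - t) * (- 1) + t * (- 1) \<le> (1 - t) * x w + t * y w"
      using elim assms by (intro add_mono mult_left_mono) auto
    ultimately show ?case by simp
  qed
  then show ?thesis using x y unfolding Linf_ball_def by auto
qed

text \<open>
  By convexity of the box the segment from \<open>x\<close> to \<open>y\<close> is feasible, and along it the difference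
  quotients are constant.
\<close>

lemma feasible_direction_tangent:
  assumes \<Omega>: "open \<Omega>" "bounded \<Omega>" and x: "x \<in> Linf_ball \<Omega>" and y: "y \<in> Linf_ball \<Omega>"
  shows "embed_L1 \<Omega> (\<lambda>w. y w - x w) \<in> tangent_cone \<Omega> (embed_L1 \<Omega> x)"
proof -
  have \<Omega>b: "\<Omega> \<in> sets borel" using \<Omega> by auto
  note ix = Linf_ball_integrable[OF \<Omega> x] and iy = Linf_ball_integrable[OF \<Omega> y]
  have h: "embed_L1 \<Omega> (\<lambda>w. y w - x w) \<in> radon \<Omega>"
    using ix iy by (simp add: radon_eq_signed_measures[OF \<Omega>b] embed_L1_signed[OF \<Omega>b])
  define t where "t k = inverse (real (Suc k))" for k
  have "t \<longlonglongrightarrow> 0" unfolding t_def by (rule LIMSEQ_inverse_real_of_nat)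
  then have t: "null_seq t" "\<And>k. 0 < t k" "\<And>k. t k \<le> 1"
    by (auto simp: null_seq_def t_def inverse_eq_divide)
  define z where "z k = embed_L1 \<Omega> (\<lambda>w. (1 - t k) * x w + t k * y w)" for k
  have zC: "z k \<in> Cset \<Omega>" for k
    unfolding z_def Cset_def using t(2)[of k] t(3)[of k] by (intro imageI Linf_ball_convex_combination x y) auto
  have "(\<lambda>A. (z k A - embed_L1 \<Omega> x A) / t k) = embed_L1 \<Omega> (\<lambda>w. y w - x w)" for k
  proof
    fix A
    have "z k A - embed_L1 \<Omega> x A = t k * (embed_L1 \<Omega> y A - embed_L1 \<Omega> x A)"
      unfolding z_def embed_L1_linear[OF \<Omega>b ix iy] by (simp add: algebra_simps)
    then show "(z k A - embed_L1 \<Omega> x A) / t k = embed_L1 \<Omega> (\<lambda>w. y w - x w) A"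
      using t(2)[of k] by (simp add: embed_L1_diff[OF \<Omega> y x])
  qed
  then have "weak_star_conv \<Omega> (\<lambda>k A. (z k A - embed_L1 \<Omega> x A) / t k) (embed_L1 \<Omega> (\<lambda>w. y w - x w))"
    using h by (simp add: weak_star_conv_def)
  then show ?thesis using h t(1) zC unfolding tangent_cone_def by blast
qed

lemma C0_measurable_lebesgue_on:
  assumes "\<phi> \<in> C0 \<Omega>" "open \<Omega>" shows "\<phi> \<in> borel_measurable (lebesgue_on \<Omega>)"
  by (rule continuous_imp_measurable_on_sets_lebesgue[OF C0_continuous_on]) (use assms in auto)

lemma C0_times_integrable:
  assumes \<Omega>: "open \<Omega>" and f: "f \<in> C0 \<Omega>" and v: "integrable (lebesgue_on \<Omega>) v"
  shows "integrable (lebesgue_on \<Omega>) (\<lambda>w. f w * v w)"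
proof -
  obtain B where B: "\<And>w. w \<in> \<Omega> \<Longrightarrow> \<bar>f w\<bar> \<le> B" using C0_bounded[OF f] by blast
  have [measurable]: "f \<in> borel_measurable (lebesgue_on \<Omega>)" "v \<in> borel_measurable (lebesgue_on \<Omega>)"
    using C0_measurable_lebesgue_on[OF f \<Omega>] v by auto
  show ?thesis
  proof (rule Bochner_Integration.integrable_bound[OF integrable_mult_right[OF v, of B]])
    show "AE w in lebesgue_on \<Omega>. norm (f w * v w) \<le> norm (B * v w)"
    proof (rule AE_I2)
      fix w assume "w \<in> space (lebesgue_on \<Omega>)"
      then have "\<bar>f w\<bar> \<le> B" using B by (simp add: space_restrict_space)
      then show "norm (f w * v w) \<le> norm (B * v w)" by (simp add: abs_mult mult_right_mono)
    qed
  qed simp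
qed

text \<open>
  Testing the normal cone condition with the feasible point \<open>- sgn \<phi>\<close> gives
  \<open>\<integral>(\<bar>\<phi>\<bar> + \<phi> x) \<le> 0\<close>, where the integrand is nonnegative because \<open>\<bar>x\<bar> \<le> 1\<close>. Hence
  \<open>x = - sgn \<phi>\<close> almost everywhere where \<open>\<phi> \<noteq> 0\<close>, and \<open>y - x\<close> has there the sign of \<open>\<phi>\<close>.
\<close>

lemma normal_cone_sign:
  assumes \<Omega>: "open \<Omega>" "bounded \<Omega>" and x: "x \<in> Linf_ball \<Omega>" and y: "y \<in> Linf_ball \<Omega>"
    and \<phi>: "\<phi> \<in> C0 \<Omega>" and n: "(\<lambda>w. - \<phi> w) \<in> normal_cone \<Omega> (embed_L1 \<Omega> x)"
  shows "AE w in lebesgue_on \<Omega>. \<phi> w * (y w - x w) = \<bar>\<phi> w\<bar> * \<bar>y w - x w\<bar>"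
proof -
  let ?L = "lebesgue_on \<Omega>"
  have [measurable]: "\<phi> \<in> borel_measurable ?L" by (rule C0_measurable_lebesgue_on[OF \<phi> \<Omega>(1)])
  have n\<phi>: "(\<lambda>w. - \<phi> w) \<in> C0 \<Omega>" using n by (auto simp: normal_cone_def)
  define s where "s w = - sgn (\<phi> w)" for w
  have "s \<in> borel_measurable ?L" unfolding s_def by measurable
  then have s: "s \<in> Linf_ball \<Omega>" by (auto simp: Linf_ball_def s_def sgn_if)
  have i: "integrable ?L (\<lambda>w. s w - x w)"
    using Linf_ball_integrable[OF \<Omega> s] Linf_ball_integrable[OF \<Omega> x] by simp
  have "pairing \<Omega> (\<lambda>w. - \<phi> w) (embed_L1 \<Omega> (\<lambda>w. s w - x w)) \<le> 0"
    using n feasible_direction_tangent[OF \<Omega> x s] by (simp add: normal_cone_def)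
  then have le: "(LINT w|?L. - \<phi> w * (s w - x w)) \<le> 0"
    unfolding pairing_embed_L1[OF \<Omega>(1) n\<phi> i] .
  have xb: "AE w in ?L. - 1 \<le> x w \<and> x w \<le> 1" and yb: "AE w in ?L. - 1 \<le> y w \<and> y w \<le> 1"
    using x y by (auto simp: Linf_ball_def)
  have ii: "integrable ?L (\<lambda>w. - \<phi> w * (s w - x w))" by (rule C0_times_integrable[OF \<Omega>(1) n\<phi> i])
  have nn: "AE w in ?L. 0 \<le> - \<phi> w * (s w - x w)"
    using xb
  proof eventually_elim
    case (elim w)
    then show ?case
      by (cases "\<phi> w" "0::real" rule: linorder_cases) (auto simp: s_def mult_nonneg_nonpos mult_nonpos_nonneg mult_nonpos_nonpos)
  qed
  have "(LINT w|?L. - \<phi> w * (s w - x w)) = 0" using le integral_nonneg_AE[OF nn] by simp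
  then have "AE w in ?L. - \<phi> w * (s w - x w) = 0"
    using integral_nonneg_eq_0_iff_AE[OF ii nn] by simp
  with yb show ?thesis
  proof eventually_elim
    case (elim w)
    show ?case
    proof (cases "\<phi> w" "0::real" rule: linorder_cases)
      case less
      then have "x w = 1" using elim by (simp add: s_def)
      then show ?thesis using less elim by (simp add: abs_if algebra_simps)
    next
      case greater
      then have "x w = - 1" using elim by (simp add: s_def)
      then show ?thesis using greater elim by simp
    qed simp
  qed
qed

section \<open>Quadratic growth of the linear term\<close>

lemma K_const_pos_imp_sublevel_bound:
  assumes \<Omega>: "open \<Omega>" "bounded \<Omega>" and \<phi>: "\<phi> \<in> C0 \<Omega>" and K: "K_const \<Omega> \<phi> > 0"
  obtains M s0 where "M > 0" "s0 > 0"
    "\<And>s. 0 < s \<Longrightarrow> s < s0 \<Longrightarrow> measure lebesgue {w \<in> \<Omega>. \<bar>\<phi> w\<bar> \<le> s} \<le> M * s"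
proof -
  let ?F = "\<lambda>s::real. ennreal s / emeasure lebesgue {w \<in> \<Omega>. \<bar>\<phi> w\<bar> \<le> s}"
  have "0 < Liminf (at_right 0) ?F"
    using K unfolding K_const_def by (auto simp: zero_less_iff_neq_zero)
  then obtain b where b: "0 < b" "b < Liminf (at_right 0) ?F" using dense by blast
  obtain a where a: "b = ennreal a" "a > 0" using b by (cases b) (auto simp: top_unique)
  have "eventually (\<lambda>s. b < ?F s) (at_right 0)" by (rule less_LiminfD[OF b(2)])
  then obtain s0 where s0: "s0 > 0" "\<And>s. 0 < s \<Longrightarrow> s < s0 \<Longrightarrow> b < ?F s"
    unfolding eventually_at_right_field by auto
  show ?thesis
  proof (rule that[of "1 / a" s0])
    fix s :: real assume s: "0 < s" "s < s0"
    let ?E = "{w \<in> \<Omega>. \<bar>\<phi> w\<bar> \<le> s}"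
    have "?E \<in> sets lebesgue"
    proof -
      have "{w \<in> space (lebesgue_on \<Omega>). \<bar>\<phi> w\<bar> \<le> s} \<in> sets (lebesgue_on \<Omega>)"
        using C0_measurable_lebesgue_on[OF \<phi> \<Omega>(1)] by measurable
      then show ?thesis using \<Omega> by (simp add: space_restrict_space sets_restrict_space_iff)
    qed
    then have "?E \<in> lmeasurable" using \<Omega>(2) by (intro bounded_set_imp_lmeasurable) (auto intro: bounded_subset)
    then have em: "emeasure lebesgue ?E = ennreal (measure lebesgue ?E)"
      by (rule emeasure_eq_measure2)
    show "measure lebesgue ?E \<le> 1 / a * s"
    proof (cases "measure lebesgue ?E = 0")
      case False
      then have pos: "measure lebesgue ?E > 0" by (simp add: zero_less_measure_iff)
      have "ennreal a < ennreal (s / measure lebesgue ?E)"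
        using s0(2)[OF s] pos s by (simp add: em a divide_ennreal)
      then have "a < s / measure lebesgue ?E" using a by (simp add: ennreal_less_iff)
      then show ?thesis using pos a by (simp add: field_simps)
    qed (use s a in auto)
  qed (use a s0 in auto)
qed

text \<open>
  Splitting at the level \<open>s\<close> gives \<open>\<parallel>v\<parallel> \<le> 2 \<L>({\<bar>\<phi>\<bar> \<le> s}) + \<integral>\<bar>\<phi>\<bar>\<bar>v\<bar> / s\<close>. With
  \<open>s = \<parallel>v\<parallel> / (4 M)\<close> the first term is at most half of the left-hand side.
\<close>

lemma weighted_L1_quadratic_growth:
  assumes \<Omega>: "open \<Omega>" "bounded \<Omega>" and \<phi>: "\<phi> \<in> C0 \<Omega>"
    and M: "M > 0" "\<And>s. 0 < s \<Longrightarrow> s < s0 \<Longrightarrow> measure lebesgue {w \<in> \<Omega>. \<bar>\<phi> w\<bar> \<le> s} \<le> M * s"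
    and v: "integrable (lebesgue_on \<Omega>) v" "AE w in lebesgue_on \<Omega>. \<bar>v w\<bar> \<le> 2"
    and small: "0 < L1_norm \<Omega> v" "L1_norm \<Omega> v < 4 * M * s0"
  shows "(L1_norm \<Omega> v)\<^sup>2 / (8 * M) \<le> (LINT w|lebesgue_on \<Omega>. \<bar>\<phi> w\<bar> * \<bar>v w\<bar>)"
proof -
  let ?L = "lebesgue_on \<Omega>"
  let ?n = "L1_norm \<Omega> v" and ?I = "LINT w|lebesgue_on \<Omega>. \<bar>\<phi> w\<bar> * \<bar>v w\<bar>"
  interpret finite_measure ?L by (rule finite_measure_lebesgue_on_bounded[OF \<Omega>])
  define s where "s = ?n / (4 * M)"
  have s: "0 < s" "s < s0" using small M(1) by (auto simp: s_def field_simps)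
  let ?E = "{w \<in> \<Omega>. \<bar>\<phi> w\<bar> \<le> s}"
  have \<phi>m [measurable]: "\<phi> \<in> borel_measurable ?L" by (rule C0_measurable_lebesgue_on[OF \<phi> \<Omega>(1)])
  have "{w \<in> space ?L. \<bar>\<phi> w\<bar> \<le> s} \<in> sets ?L" by measurable
  then have E: "?E \<in> sets ?L" by (simp add: space_restrict_space)
  have mE: "measure ?L ?E = measure lebesgue ?E" using \<Omega> by (intro measure_restrict_space) auto
  have iv: "integrable ?L (\<lambda>w. \<bar>\<phi> w\<bar> * \<bar>v w\<bar>)"
    using integrable_abs[OF C0_times_integrable[OF \<Omega>(1) \<phi> v(1)]] by (simp add: abs_mult)
  have iE: "integrable ?L (\<lambda>w. 2 * indicator ?E w :: real)" using E by (intro integrable_mult_right) (auto simp: less_top[symmetric])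
  have "?n \<le> (LINT w|?L. 2 * indicator ?E w + (\<bar>\<phi> w\<bar> * \<bar>v w\<bar>) / s)"
    unfolding L1_norm_def
  proof (rule integral_mono_AE)
    show "AE w in ?L. \<bar>v w\<bar> \<le> 2 * indicator ?E w + (\<bar>\<phi> w\<bar> * \<bar>v w\<bar>) / s"
      using v(2) AE_space
    proof eventually_elim
      case (elim w)
      show ?case
      proof (cases "w \<in> ?E")
        case True
        have "0 \<le> (\<bar>\<phi> w\<bar> * \<bar>v w\<bar>) / s" using s by simp
        then show ?thesis using True elim by simp
      next
        case False
        then have "s * \<bar>v w\<bar> \<le> \<bar>\<phi> w\<bar> * \<bar>v w\<bar>"
          using elim by (intro mult_right_mono) (auto simp: space_restrict_space)
        then show ?thesis using False s by (simp add: field_simps)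
      qed
    qed
  qed (use v iv iE in auto)
  also have "\<dots> = 2 * measure ?L ?E + ?I / s"
    using iE iv E by (subst Bochner_Integration.integral_add) (auto simp: Int_absorb2 space_restrict_space)
  also have "measure ?L ?E \<le> M * s" using M(2)[OF s] mE by simp
  finally have "?n \<le> 2 * (M * s) + ?I / s" by simp
  then have "?n / 2 \<le> ?I / s" using M(1) by (simp add: s_def)
  then have "?n / 2 * s \<le> ?I" using s by (simp add: field_simps)
  then show ?thesis by (simp add: s_def power2_eq_square)
qed

section \<open>The second-order characterisation\<close>

lemma pairing_signed_linear:
  assumes \<Omega>: "open \<Omega>" and f: "f \<in> C0 \<Omega>" and \<mu>: "\<mu> \<in> signed_measures \<Omega>" "\<nu> \<in> signed_measures \<Omega>"
  shows "pairing \<Omega> f (\<lambda>A. a * \<mu> A + b * \<nu> A) = a * pairing \<Omega> f \<mu> + b * pairing \<Omega> f \<nu>"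
proof -
  obtain B where B: "\<And>w. w \<in> \<Omega> \<Longrightarrow> \<bar>f w\<bar> \<le> B" using C0_bounded[OF f] by blast
  show ?thesis by (rule pairing_linear[OF borel_open[OF \<Omega>] C0_measurable[OF \<Omega> f] B \<mu>])
qed

lemma signed_measures_zero: "(\<lambda>A. 0) \<in> signed_measures \<Omega>"
  by (simp add: signed_measures_def)

lemma weak_star_conv_linear:
  assumes \<Omega>: "open \<Omega>" and h: "weak_star_conv \<Omega> h h0" and g: "weak_star_conv \<Omega> g g0"
  shows "weak_star_conv \<Omega> (\<lambda>k A. a * h k A + b * g k A) (\<lambda>A. a * h0 A + b * g0 A)"
proof -
  note R = radon_eq_signed_measures[OF borel_open[OF \<Omega>]]
  have s: "h k \<in> signed_measures \<Omega>" "g k \<in> signed_measures \<Omega>" "h0 \<in> signed_measures \<Omega>" "g0 \<in> signed_measures \<Omega>" for k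
    using h g by (auto simp: weak_star_conv_def R)
  show ?thesis
    unfolding weak_star_conv_def R
  proof (intro conjI allI ballI signed_measures_linear s)
    fix f assume f: "f \<in> C0 \<Omega>"
    then show "(\<lambda>k. pairing \<Omega> f (\<lambda>A. a * h k A + b * g k A)) \<longlonglongrightarrow> pairing \<Omega> f (\<lambda>A. a * h0 A + b * g0 A)"
      using h g unfolding weak_star_conv_def
      by (simp add: pairing_signed_linear[OF \<Omega> f] s) (intro tendsto_intros; blast)
  qed
qed

lemma weak_star_conv_const: "\<mu> \<in> radon \<Omega> \<Longrightarrow> weak_star_conv \<Omega> (\<lambda>k. \<mu>) \<mu>"
  by (simp add: weak_star_conv_def)

lemma bilinear_zero:
  assumes "open \<Omega>" "bounded_bilinear_form \<Omega> B" shows "B (\<lambda>A. 0) (\<lambda>A. 0) = 0"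
proof -
  have z: "(\<lambda>A. 0) \<in> radon \<Omega>" using signed_measures_zero by (simp add: radon_eq_signed_measures[OF borel_open[OF assms(1)]])
  have "\<forall>\<mu>\<in>radon \<Omega>. \<forall>\<nu>\<in>radon \<Omega>. \<forall>\<rho>\<in>radon \<Omega>. \<forall>a b.
      B (\<lambda>A. a * \<mu> A + b * \<nu> A) \<rho> = a * B \<mu> \<rho> + b * B \<nu> \<rho>"
    using assms(2) unfolding bounded_bilinear_form_def by blast
  from this[rule_format, OF z z z, of 0 0] show ?thesis by simp
qed

text \<open>
  The separating function \<open>f\<close> keeps the \<open>L\<^sup>1\<close> distance \<open>t\<^sub>k \<parallel>g\<^sub>k\<parallel>\<close> above \<open>t\<^sub>k F / 2\<close>, where
  \<open>F = \<langle>f, h\<rangle>\<close> depends on \<open>h\<close> only. Growth then bounds the curvature of \<open>h\<close> plus \<open>J'' h\<^sup>2\<close> from below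
  by \<open>c F\<^sup>2 / 4\<close>.
\<close>

lemma quadratic_growth_imp_positive_curvature:
  fixes \<Omega> :: "'a::euclidean_space set"
  assumes \<Omega>: "open \<Omega>" "bounded \<Omega>" and x: "x \<in> Linf_ball \<Omega>"
    and J: "second_order_expansion \<Omega> J (embed_L1 \<Omega> x) \<phi> J2"
    and J2: "weak_star_continuous \<Omega> (\<lambda>h. J2 h h)"
    and c: "c > 0" and \<epsilon>: "\<epsilon> > 0"
    and growth: "\<And>y. y \<in> Linf_ball \<Omega> \<Longrightarrow> tv_norm \<Omega> (\<lambda>A. embed_L1 \<Omega> y A - embed_L1 \<Omega> x A) \<le> \<epsilon> \<Longrightarrow>
      J (embed_L1 \<Omega> y) \<ge> J (embed_L1 \<Omega> x) + c / 2 * (L1_norm \<Omega> (\<lambda>w. y w - x w))\<^sup>2"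
    and h: "h \<in> critical_cone \<Omega> (embed_L1 \<Omega> x) \<phi>" "h \<noteq> (\<lambda>A. 0)"
  shows "curvature \<Omega> (embed_L1 \<Omega> x) \<phi> h + ereal (J2 h h) > 0"
proof -
  let ?x = "embed_L1 \<Omega> x"
  note R = radon_eq_signed_measures[OF borel_open[OF \<Omega>(1)]]
  have \<phi>: "\<phi> \<in> C0 \<Omega>" using J by (simp add: second_order_expansion_def)
  have hr: "h \<in> radon \<Omega>" and h\<phi>: "pairing \<Omega> \<phi> h = 0" using h(1) by (auto simp: critical_cone_def)
  have hs: "h \<in> signed_measures \<Omega>" using hr by (simp add: R)
  obtain f where f: "f \<in> C0 \<Omega>" "\<And>w. \<bar>f w\<bar> \<le> 1" and fh: "pairing \<Omega> f h > 0"
    using C0_separates_measures[OF \<Omega> hs h(2)] by metis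
  define F where "F = pairing \<Omega> f h"
  have F: "F > 0" using fh by (simp add: F_def)
  have "ereal (c * F\<^sup>2 / 4 - J2 h h) \<le> curvature \<Omega> ?x \<phi> h"
    unfolding curvature_def
  proof (rule Inf_greatest, clarify)
    fix r :: "nat \<Rightarrow> 'a set \<Rightarrow> real" and t
    assume r: "\<forall>k. r k \<in> radon \<Omega>" and t: "null_seq t"
      and tr: "weak_star_conv \<Omega> (\<lambda>k A. t k * r k A) (\<lambda>A. 0)"
      and feas: "\<forall>k. (\<lambda>A. ?x A + t k * h A + 1 / 2 * (t k)\<^sup>2 * r k A) \<in> Cset \<Omega>"
    have t0: "t k > 0" for k using t by (simp add: null_seq_def)
    have tl: "t \<longlonglongrightarrow> 0" using t by (simp add: null_seq_def)
    have rs: "r k \<in> signed_measures \<Omega>" for k using r by (simp add: R)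
    define g where "g k = (\<lambda>A. 1 * h A + 1 / 2 * (t k * r k A))" for k
    have gh: "weak_star_conv \<Omega> g h"
      using weak_star_conv_linear[OF \<Omega>(1) weak_star_conv_const[OF hr] tr, of 1 "1/2"]
      by (simp add: g_def[abs_def])
    have gs: "g k \<in> signed_measures \<Omega>" for k using gh by (auto simp: weak_star_conv_def R)
    have xg: "(\<lambda>A. ?x A + t k * g k A) = (\<lambda>A. ?x A + t k * h A + 1 / 2 * (t k)\<^sup>2 * r k A)" for k
      by (simp add: g_def power2_eq_square algebra_simps)
    have feas': "\<forall>k. (\<lambda>A. ?x A + t k * g k A) \<in> Cset \<Omega>" using feas unfolding xg .
    then have "\<forall>k. \<exists>y\<in>Linf_ball \<Omega>. embed_L1 \<Omega> y = (\<lambda>A. ?x A + t k * g k A)"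
      unfolding Cset_def image_iff by (metis (no_types, lifting))
    then obtain y where y: "\<And>k. y k \<in> Linf_ball \<Omega>" "\<And>k. embed_L1 \<Omega> (y k) = (\<lambda>A. ?x A + t k * g k A)"
      by metis
    have yx: "embed_L1 \<Omega> (\<lambda>w. y k w - x w) = (\<lambda>A. t k * g k A)" for k
      using embed_L1_diff[OF \<Omega> y(1)[of k] x] by (auto simp: y(2))
    have iyx: "integrable (lebesgue_on \<Omega>) (\<lambda>w. y k w - x w)" for k
      using Linf_ball_integrable[OF \<Omega> y(1)[of k]] Linf_ball_integrable[OF \<Omega> x] by simp
    define e where "e k = (J (\<lambda>A. ?x A + t k * g k A) - J ?x - t k * pairing \<Omega> \<phi> (g k)
               - 1/2 * (t k)\<^sup>2 * J2 (g k) (g k)) / (t k)\<^sup>2" for k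
    have el: "e \<longlonglongrightarrow> 0"
      unfolding e_def using J t gh feas' unfolding second_order_expansion_def by blast
    have J2l: "(\<lambda>k. J2 (g k) (g k)) \<longlonglongrightarrow> J2 h h"
      using J2 gh unfolding weak_star_continuous_def by blast
    have p: "pairing \<Omega> \<phi> (g k) = 1 / 2 * t k * pairing \<Omega> \<phi> (r k)" for k
    proof -
      have "g k = (\<lambda>A. 1 * h A + (1 / 2 * t k) * r k A)" by (simp add: g_def)
      then show ?thesis using pairing_signed_linear[OF \<Omega>(1) \<phi> hs rs, of 1 "1 / 2 * t k"] h\<phi> by simp
    qed
    obtain M where M: "\<And>k. tv_norm \<Omega> (g k) \<le> M" using weak_star_conv_tv_bounded[OF \<Omega> gh] by blast
    have "(\<lambda>k. t k * M) \<longlonglongrightarrow> 0 * M" by (intro tendsto_intros tl)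
    then have small: "\<forall>\<^sub>F k in sequentially. t k * M < \<epsilon>" using \<epsilon> by (intro order_tendstoD) auto
    have "(\<lambda>k. pairing \<Omega> f (g k)) \<longlonglongrightarrow> F" using gh f(1) by (simp add: weak_star_conv_def F_def)
    then have big: "\<forall>\<^sub>F k in sequentially. F / 2 < pairing \<Omega> f (g k)" using F by (intro order_tendstoD) auto
    have ev: "\<forall>\<^sub>F k in sequentially. c * F\<^sup>2 / 4 - J2 (g k) (g k) - 2 * e k \<le> pairing \<Omega> \<phi> (r k)"
      using small big
    proof eventually_elim
      case (elim k)
      have "tv_norm \<Omega> (\<lambda>A. embed_L1 \<Omega> (y k) A - ?x A) = tv_norm \<Omega> (\<lambda>A. t k * g k A)" by (simp add: y(2))
      also have "\<dots> \<le> \<bar>t k\<bar> * tv_norm \<Omega> (g k)" by (rule tv_norm_scale_le[OF \<Omega> gs])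
      also have "\<dots> \<le> t k * M" using t0[of k] M[of k] by (simp add: mult_left_mono)
      finally have "tv_norm \<Omega> (\<lambda>A. embed_L1 \<Omega> (y k) A - ?x A) \<le> \<epsilon>" using elim by simp
      from growth[OF y(1) this]
      have gr: "J (\<lambda>A. ?x A + t k * g k A) \<ge> J ?x + c / 2 * (L1_norm \<Omega> (\<lambda>w. y k w - x w))\<^sup>2" by (simp add: y(2))
      have "t k * pairing \<Omega> f (g k) = pairing \<Omega> f (embed_L1 \<Omega> (\<lambda>w. y k w - x w))"
        using pairing_signed_linear[OF \<Omega>(1) f(1) gs[of k] gs[of k], of "t k" 0] by (simp add: yx)
      also have "\<dots> = (LINT w|lebesgue_on \<Omega>. f w * (y k w - x w))" by (rule pairing_embed_L1[OF \<Omega>(1) f(1) iyx])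
      also have "\<dots> \<le> (LINT w|lebesgue_on \<Omega>. \<bar>y k w - x w\<bar>)"
      proof (rule integral_mono[OF C0_times_integrable[OF \<Omega>(1) f(1) iyx] integrable_abs[OF iyx]])
        fix w
        have "f w * (y k w - x w) \<le> \<bar>f w\<bar> * \<bar>y k w - x w\<bar>" by (simp add: abs_mult[symmetric])
        also have "\<dots> \<le> 1 * \<bar>y k w - x w\<bar>" by (intro mult_right_mono f) auto
        finally show "f w * (y k w - x w) \<le> \<bar>y k w - x w\<bar>" by simp
      qed
      finally have "t k * pairing \<Omega> f (g k) \<le> L1_norm \<Omega> (\<lambda>w. y k w - x w)" by (simp add: L1_norm_def)
      moreover have "t k * (F / 2) \<le> t k * pairing \<Omega> f (g k)" using elim t0[of k] by (intro mult_left_mono) auto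
      ultimately have "t k * (F / 2) \<le> L1_norm \<Omega> (\<lambda>w. y k w - x w)" by (rule order_trans[rotated])
      then have "(t k * (F / 2))\<^sup>2 \<le> (L1_norm \<Omega> (\<lambda>w. y k w - x w))\<^sup>2"
        by (rule power_mono) (use t0[of k] F in simp)
      then have "c / 2 * (t k * (F / 2))\<^sup>2 \<le> c / 2 * (L1_norm \<Omega> (\<lambda>w. y k w - x w))\<^sup>2"
        by (rule mult_left_mono) (use c in simp)
      then have "c / 2 * (t k * (F / 2))\<^sup>2 \<le> J (\<lambda>A. ?x A + t k * g k A) - J ?x"
        using gr by linarith
      moreover have "J (\<lambda>A. ?x A + t k * g k A) - J ?x
          = (t k)\<^sup>2 * (e k + 1/2 * pairing \<Omega> \<phi> (r k) + 1/2 * J2 (g k) (g k))"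
        using t0[of k] unfolding e_def p by (simp add: field_simps power2_eq_square)
      ultimately have "(t k)\<^sup>2 * (c * F\<^sup>2 / 8) \<le> (t k)\<^sup>2 * (e k + 1/2 * pairing \<Omega> \<phi> (r k) + 1/2 * J2 (g k) (g k))"
        by (simp add: power_mult_distrib power_divide field_simps)
      then have "c * F\<^sup>2 / 8 \<le> e k + 1/2 * pairing \<Omega> \<phi> (r k) + 1/2 * J2 (g k) (g k)"
        using t0[of k] by simp
      then show ?case by simp
    qed
    have "(\<lambda>k. c * F\<^sup>2 / 4 - J2 (g k) (g k) - 2 * e k) \<longlonglongrightarrow> c * F\<^sup>2 / 4 - J2 h h - 2 * 0"
      by (intro tendsto_intros J2l el)
    then have "(\<lambda>k. ereal (c * F\<^sup>2 / 4 - J2 (g k) (g k) - 2 * e k)) \<longlonglongrightarrow> ereal (c * F\<^sup>2 / 4 - J2 h h)" by simp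
    then have "ereal (c * F\<^sup>2 / 4 - J2 h h) = liminf (\<lambda>k. ereal (c * F\<^sup>2 / 4 - J2 (g k) (g k) - 2 * e k))"
      by (rule lim_imp_Liminf[OF sequentially_bot, symmetric])
    also have "\<dots> \<le> liminf (\<lambda>k. ereal (pairing \<Omega> \<phi> (r k)))"
      using ev by (intro Liminf_mono) (auto elim!: eventually_mono)
    finally show "ereal (c * F\<^sup>2 / 4 - J2 h h) \<le> liminf (\<lambda>k. ereal (pairing \<Omega> \<phi> (r k)))" .
  qed
  then have "ereal (c * F\<^sup>2 / 4 - J2 h h) + ereal (J2 h h) \<le> curvature \<Omega> ?x \<phi> h + ereal (J2 h h)"
    by (rule add_right_mono)
  moreover have "0 < ereal (c * F\<^sup>2 / 4 - J2 h h) + ereal (J2 h h)" using c F by simp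
  ultimately show ?thesis by (rule less_le_trans[rotated])
qed

text \<open>
  Sequences violating growth at rates tending to zero produce a critical direction \<open>h\<close> whose
  curvature is at most \<open>- J'' h\<^sup>2\<close>. The growth of the linear term excludes \<open>h = 0\<close>.
\<close>

lemma positive_curvature_imp_quadratic_growth:
  fixes \<Omega> :: "'a::euclidean_space set"
  assumes \<Omega>: "open \<Omega>" "bounded \<Omega>" and x: "x \<in> Linf_ball \<Omega>"
    and J: "second_order_expansion \<Omega> J (embed_L1 \<Omega> x) \<phi> J2"
    and J2: "weak_star_continuous \<Omega> (\<lambda>h. J2 h h)"
    and normal: "(\<lambda>w. - \<phi> w) \<in> normal_cone \<Omega> (embed_L1 \<Omega> x)"
    and K: "K_const \<Omega> \<phi> > 0"
    and pos: "\<And>h. h \<in> critical_cone \<Omega> (embed_L1 \<Omega> x) \<phi> \<Longrightarrow> h \<noteq> (\<lambda>A. 0) \<Longrightarrow>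
      curvature \<Omega> (embed_L1 \<Omega> x) \<phi> h + ereal (J2 h h) > 0"
  shows "\<exists>c>0. \<exists>\<epsilon>>0. \<forall>y \<in> Linf_ball \<Omega>.
    tv_norm \<Omega> (\<lambda>A. embed_L1 \<Omega> y A - embed_L1 \<Omega> x A) \<le> \<epsilon> \<longrightarrow>
    J (embed_L1 \<Omega> y) \<ge> J (embed_L1 \<Omega> x) + c / 2 * (L1_norm \<Omega> (\<lambda>w. y w - x w))\<^sup>2"
proof (rule ccontr)
  let ?x = "embed_L1 \<Omega> x"
  note \<Omega>b = borel_open[OF \<Omega>(1)]
  note R = radon_eq_signed_measures[OF \<Omega>b]
  have \<phi>: "\<phi> \<in> C0 \<Omega>" and bil: "bounded_bilinear_form \<Omega> J2" using J by (auto simp: second_order_expansion_def)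
  note ix = Linf_ball_integrable[OF \<Omega> x]
  define \<delta> where "\<delta> n = inverse (real (Suc n))" for n
  have \<delta>0: "\<delta> n > 0" for n by (simp add: \<delta>_def)
  have \<delta>l: "\<delta> \<longlonglongrightarrow> 0" unfolding \<delta>_def by (rule LIMSEQ_inverse_real_of_nat)
  assume neg: "\<not> ?thesis"
  have "\<exists>y. y \<in> Linf_ball \<Omega> \<and> tv_norm \<Omega> (\<lambda>A. embed_L1 \<Omega> y A - ?x A) \<le> \<delta> n \<and>
      J (embed_L1 \<Omega> y) < J ?x + \<delta> n / 2 * (L1_norm \<Omega> (\<lambda>w. y w - x w))\<^sup>2" for n
    using neg \<delta>0[of n] not_le by blast
  then obtain Y where Y: "\<And>n. Y n \<in> Linf_ball \<Omega>" "\<And>n. tv_norm \<Omega> (\<lambda>A. embed_L1 \<Omega> (Y n) A - ?x A) \<le> \<delta> n"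
    "\<And>n. J (embed_L1 \<Omega> (Y n)) < J ?x + \<delta> n / 2 * (L1_norm \<Omega> (\<lambda>w. Y n w - x w))\<^sup>2" by metis
  have iY: "integrable (lebesgue_on \<Omega>) (\<lambda>w. Y n w - x w)" for n
    using Linf_ball_integrable[OF \<Omega> Y(1)[of n]] ix by simp
  define T where "T n = L1_norm \<Omega> (\<lambda>w. Y n w - x w)" for n
  have eY: "embed_L1 \<Omega> (\<lambda>w. Y n w - x w) = (\<lambda>A. embed_L1 \<Omega> (Y n) A - ?x A)" for n
    using embed_L1_diff[OF \<Omega> Y(1)[of n] x] by auto
  have T\<delta>: "T n \<le> \<delta> n" for n
    using L1_norm_le_tv_norm[OF \<Omega>b iY[of n]] Y(2)[of n] by (simp add: T_def eY)
  \<comment> \<open>If \<open>Y n = x\<close> almost everywhere, both represent the same measure, and the strict inequality for \<open>J\<close> fails.\<close>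
  have T0: "T n > 0" for n
  proof (rule ccontr)
    assume "\<not> T n > 0"
    moreover have "T n \<ge> 0" unfolding T_def L1_norm_def by simp
    ultimately have T: "T n = 0" by simp
    then have "AE w in lebesgue_on \<Omega>. \<bar>Y n w - x w\<bar> = 0"
      using iY[of n] unfolding T_def L1_norm_def by (subst (asm) integral_nonneg_eq_0_iff_AE) auto
    then have ae: "AE w in lebesgue_on \<Omega>. indicator A w * (Y n w - x w) = 0" for A
      by eventually_elim simp
    have "embed_L1 \<Omega> (\<lambda>w. Y n w - x w) A = 0" for A
      using integral_eq_zero_AE[OF ae[of A]] by (simp add: embed_L1_eq_weighted_image[OF \<Omega>b] weighted_image_def)
    then have "embed_L1 \<Omega> (Y n) A = ?x A" for A by (simp add: eY)
    then have "embed_L1 \<Omega> (Y n) = ?x" by blast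
    then show False using Y(3)[of n] T by (simp add: T_def)
  qed
  \<comment> \<open>The vanishing second term puts \<open>v\<close> in the form of a linear combination.\<close>
  define v where "v n w = (1 / T n) * (Y n w - x w) + 0 * x w" for n w
  have iv: "integrable (lebesgue_on \<Omega>) (v n)" for n
    unfolding v_def using iY[of n] ix by simp
  have nv: "L1_norm \<Omega> (v n) = 1" for n
    using T0[of n] unfolding L1_norm_def v_def by (simp add: abs_mult T_def L1_norm_def)
  obtain r h where r: "strict_mono r" and wh: "weak_star_conv \<Omega> (\<lambda>k. embed_L1 \<Omega> (v (r k))) h"
    by (rule weak_star_subsequence[of \<Omega> v, OF \<Omega> iv nv])
  define t where "t k = T (r k)" for k
  define g where "g k = embed_L1 \<Omega> (v (r k))" for k
  have gh: "weak_star_conv \<Omega> g h" using wh by (simp add: g_def[abs_def])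
  have t0: "t k > 0" for k using T0 by (simp add: t_def)
  have \<delta>r: "(\<lambda>k. \<delta> (r k)) \<longlonglongrightarrow> 0" using LIMSEQ_subseq_LIMSEQ[OF \<delta>l r] by (simp add: o_def)
  have tl: "t \<longlonglongrightarrow> 0"
    by (rule tendsto_sandwich[OF _ _ tendsto_const \<delta>r]) (auto simp: t_def T0 T\<delta> less_imp_le)
  have t: "null_seq t" using t0 tl by (simp add: null_seq_def)
  have gY: "g k = (\<lambda>A. (embed_L1 \<Omega> (Y (r k)) A - ?x A) / t k)" for k
    unfolding g_def v_def embed_L1_linear[OF \<Omega>b iY ix] by (simp add: eY t_def)
  have xg: "(\<lambda>A. ?x A + t k * g k A) = embed_L1 \<Omega> (Y (r k))" for k
    using t0[of k] by (simp add: gY)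
  have feas: "\<forall>k. (\<lambda>A. ?x A + t k * g k A) \<in> Cset \<Omega>" using Y(1) unfolding xg Cset_def by blast
  have gs: "g k \<in> signed_measures \<Omega>" and hs: "h \<in> signed_measures \<Omega>" for k
    using gh by (auto simp: weak_star_conv_def R)
  define e where "e k = (J (\<lambda>A. ?x A + t k * g k A) - J ?x - t k * pairing \<Omega> \<phi> (g k)
               - 1/2 * (t k)\<^sup>2 * J2 (g k) (g k)) / (t k)\<^sup>2" for k
  have el: "e \<longlonglongrightarrow> 0"
    unfolding e_def using J t gh feas unfolding second_order_expansion_def by blast
  have J2l: "(\<lambda>k. J2 (g k) (g k)) \<longlonglongrightarrow> J2 h h"
    using J2 gh unfolding weak_star_continuous_def by blast
  define p where "p k = pairing \<Omega> \<phi> (g k)" for k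
  define u where "u k = 1/2 * \<delta> (r k) - 1/2 * J2 (g k) (g k) - e k" for k
  have "u \<longlonglongrightarrow> 1/2 * 0 - 1/2 * J2 h h - 0" unfolding u_def by (intro tendsto_intros \<delta>r J2l el)
  then have ul: "u \<longlonglongrightarrow> - 1/2 * J2 h h" by simp
  have pu: "p k / t k \<le> u k" for k
  proof -
    have "(t k)\<^sup>2 * e k + t k * p k + 1/2 * (t k)\<^sup>2 * J2 (g k) (g k) = J (embed_L1 \<Omega> (Y (r k))) - J ?x"
      using t0[of k] unfolding e_def p_def xg by (simp add: field_simps)
    also have "\<dots> \<le> \<delta> (r k) / 2 * (t k)\<^sup>2" using Y(3)[of "r k"] by (simp add: t_def T_def)
    finally have "t k * p k \<le> (t k)\<^sup>2 * u k" by (simp add: u_def algebra_simps)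
    then show ?thesis using t0[of k] by (simp add: power2_eq_square field_simps)
  qed
  have pI: "t k * p k = (LINT w|lebesgue_on \<Omega>. \<bar>\<phi> w\<bar> * \<bar>Y (r k) w - x w\<bar>)" for k
  proof -
    have "t k * p k = pairing \<Omega> \<phi> (\<lambda>A. t k * g k A)"
      using pairing_signed_linear[OF \<Omega>(1) \<phi> gs[of k] gs[of k], of "t k" 0] by (simp add: p_def)
    also have "(\<lambda>A. t k * g k A) = embed_L1 \<Omega> (\<lambda>w. Y (r k) w - x w)" using t0[of k] by (simp add: gY eY)
    also have "pairing \<Omega> \<phi> \<dots> = (LINT w|lebesgue_on \<Omega>. \<phi> w * (Y (r k) w - x w))"
      by (rule pairing_embed_L1[OF \<Omega>(1) \<phi> iY])
    also have "\<dots> = (LINT w|lebesgue_on \<Omega>. \<bar>\<phi> w\<bar> * \<bar>Y (r k) w - x w\<bar>)"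
    proof -
      have "\<phi> \<in> borel_measurable (lebesgue_on \<Omega>)" "(\<lambda>w. Y (r k) w - x w) \<in> borel_measurable (lebesgue_on \<Omega>)"
        using C0_measurable_lebesgue_on[OF \<phi> \<Omega>(1)] iY[of "r k"] by auto
      then show ?thesis
        by (intro integral_cong_AE normal_cone_sign[OF \<Omega> x Y(1) \<phi> normal] borel_measurable_times borel_measurable_abs)
    qed
    finally show ?thesis .
  qed
  have p0: "p k \<ge> 0" for k
  proof -
    have "t k * p k \<ge> 0" unfolding pI by (intro Bochner_Integration.integral_nonneg) auto
    then show ?thesis using t0[of k] by (simp add: zero_le_mult_iff)
  qed
  obtain M s0 where M: "M > 0" "s0 > 0" "\<And>s. 0 < s \<Longrightarrow> s < s0 \<Longrightarrow> measure lebesgue {w \<in> \<Omega>. \<bar>\<phi> w\<bar> \<le> s} \<le> M * s"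
    using K_const_pos_imp_sublevel_bound[OF \<Omega> \<phi> K] by metis
  have "\<forall>\<^sub>F k in sequentially. t k < 4 * M * s0" using tl M by (intro order_tendstoD) auto
  then have "\<forall>\<^sub>F k in sequentially. 1 / (8 * M) \<le> u k"
  proof eventually_elim
    case (elim k)
    have "AE w in lebesgue_on \<Omega>. - 1 \<le> Y (r k) w \<and> Y (r k) w \<le> 1" "AE w in lebesgue_on \<Omega>. - 1 \<le> x w \<and> x w \<le> 1"
      using Y(1) x by (auto simp: Linf_ball_def)
    then have ae: "AE w in lebesgue_on \<Omega>. \<bar>Y (r k) w - x w\<bar> \<le> 2" by eventually_elim auto
    have "(L1_norm \<Omega> (\<lambda>w. Y (r k) w - x w))\<^sup>2 / (8 * M) \<le> (LINT w|lebesgue_on \<Omega>. \<bar>\<phi> w\<bar> * \<bar>Y (r k) w - x w\<bar>)"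
      by (rule weighted_L1_quadratic_growth[OF \<Omega> \<phi> M(1) M(3) iY ae])
        (use elim t0[of k] in \<open>auto simp: t_def T_def\<close>)
    then have "(t k)\<^sup>2 / (8 * M) \<le> t k * p k" unfolding pI by (simp add: t_def T_def)
    then have "1 / (8 * M) \<le> p k / t k" using t0[of k] M(1) by (simp add: power2_eq_square field_simps)
    then show ?case using pu[of k] by simp
  qed
  then have "1 / (8 * M) \<le> - 1/2 * J2 h h"
    by (intro tendsto_lowerbound[OF ul]) auto
  moreover have "0 < 1 / (8 * M)" using M(1) by simp
  ultimately have "J2 h h < 0" by linarith
  then have hne: "h \<noteq> (\<lambda>A. 0)" using bilinear_zero[OF \<Omega>(1) bil] by auto
  have "(\<lambda>k. t k * u k) \<longlonglongrightarrow> 0 * (- 1/2 * J2 h h)" by (intro tendsto_intros tl ul)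
  then have tu: "(\<lambda>k. t k * u k) \<longlonglongrightarrow> 0" by simp
  have "p \<longlonglongrightarrow> 0"
  proof (rule tendsto_sandwich[OF _ _ tendsto_const tu])
    have "p k \<le> t k * u k" for k using pu[of k] t0[of k] by (simp add: field_simps)
    then show "\<forall>\<^sub>F k in sequentially. p k \<le> t k * u k" by simp
  qed (simp add: p0)
  moreover have "p \<longlonglongrightarrow> pairing \<Omega> \<phi> h" using gh \<phi> by (simp add: weak_star_conv_def p_def[abs_def])
  ultimately have h\<phi>: "pairing \<Omega> \<phi> h = 0" using LIMSEQ_unique by blast
  have "h \<in> tangent_cone \<Omega> ?x"
    unfolding tangent_cone_def
  proof (intro CollectI conjI exI)
    show "h \<in> radon \<Omega>" using hs by (simp add: R)
    show "null_seq t" by (rule t)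
    show "\<forall>k. embed_L1 \<Omega> (Y (r k)) \<in> Cset \<Omega>" using Y(1) by (auto simp: Cset_def)
    show "weak_star_conv \<Omega> (\<lambda>k A. (embed_L1 \<Omega> (Y (r k)) A - ?x A) / t k) h"
      using gh by (simp add: gY[abs_def])
  qed
  then have hc: "h \<in> critical_cone \<Omega> ?x \<phi>" using hs h\<phi> by (simp add: critical_cone_def R)
  \<comment> \<open>This choice makes \<open>x + t\<^sub>k h + t\<^sub>k\<^sup>2 q\<^sub>k / 2\<close> equal to \<open>x + t\<^sub>k g\<^sub>k\<close>, which is feasible.\<close>
  define q where "q k = (\<lambda>A. (2 / t k) * g k A + (- 2 / t k) * h A)" for k
  have qs: "q k \<in> signed_measures \<Omega>" for k unfolding q_def by (intro signed_measures_linear gs hs)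
  have q\<phi>: "pairing \<Omega> \<phi> (q k) = 2 * (p k / t k)" for k
    unfolding q_def pairing_signed_linear[OF \<Omega>(1) \<phi> gs hs] by (simp add: h\<phi> p_def)
  have tq: "(\<lambda>A. t k * q k A) = (\<lambda>A. 2 * g k A + (- 2) * h A)" for k
    using t0[of k] by (auto simp: q_def field_simps)
  have "weak_star_conv \<Omega> (\<lambda>k A. t k * q k A) (\<lambda>A. 0)"
    using weak_star_conv_linear[OF \<Omega>(1) gh weak_star_conv_const, of h 2 "- 2"] hs
    unfolding tq by (simp add: R)
  moreover have "(\<lambda>A. ?x A + t k * h A + 1 / 2 * (t k)\<^sup>2 * q k A) \<in> Cset \<Omega>" for k
  proof -
    have "(\<lambda>A. ?x A + t k * h A + 1 / 2 * (t k)\<^sup>2 * q k A) = (\<lambda>A. ?x A + t k * g k A)"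
      using t0[of k] by (simp add: q_def power2_eq_square field_simps)
    then show ?thesis using feas by simp
  qed
  ultimately have "curvature \<Omega> ?x \<phi> h \<le> liminf (\<lambda>k. ereal (pairing \<Omega> \<phi> (q k)))"
    unfolding curvature_def using t qs by (intro Inf_lower) (auto simp: R)
  also have "\<dots> \<le> liminf (\<lambda>k. ereal (2 * u k))"
    unfolding q\<phi> by (intro Liminf_mono always_eventually allI) (simp only: ereal_less_eq, intro mult_left_mono pu, simp)
  also have "\<dots> = ereal (- J2 h h)"
  proof -
    have "(\<lambda>k. 2 * u k) \<longlonglongrightarrow> 2 * (- 1/2 * J2 h h)" by (intro tendsto_intros ul)
    then have "(\<lambda>k. ereal (2 * u k)) \<longlonglongrightarrow> ereal (- J2 h h)" by simp
    then show ?thesis by (rule lim_imp_Liminf[OF sequentially_bot])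
  qed
  finally have "curvature \<Omega> ?x \<phi> h + ereal (J2 h h) \<le> ereal (- J2 h h) + ereal (J2 h h)" by (rule add_right_mono)
  also have "\<dots> = 0" by simp
  finally show False using pos[OF hc hne] by (rule leD[THEN notE])
qed

theorem theorem6p4:
  fixes \<Omega> :: "'a::euclidean_space set"
    and xbar :: "'a \<Rightarrow> real"
    and J :: "('a set \<Rightarrow> real) \<Rightarrow> real"
    and \<phi> :: "'a \<Rightarrow> real"
    and J2 :: "('a set \<Rightarrow> real) \<Rightarrow> ('a set \<Rightarrow> real) \<Rightarrow> real"
  assumes "bounded_lipschitz_domain \<Omega>"
    and "xbar \<in> Linf_ball \<Omega>"
    and "second_order_expansion \<Omega> J (embed_L1 \<Omega> xbar) \<phi> J2"
    and "weak_star_continuous \<Omega> (\<lambda>h. J2 h h)"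
    and "(\<lambda>w. - \<phi> w) \<in> normal_cone \<Omega> (embed_L1 \<Omega> xbar)"
    and "K_const \<Omega> \<phi> > 0"
  shows "(\<forall>h \<in> critical_cone \<Omega> (embed_L1 \<Omega> xbar) \<phi> - {\<lambda>A. 0}.
            curvature \<Omega> (embed_L1 \<Omega> xbar) \<phi> h + ereal (J2 h h) > 0)
     \<longleftrightarrow> (\<exists>c>0. \<exists>\<epsilon>>0. \<forall>x \<in> Linf_ball \<Omega>.
            tv_norm \<Omega> (\<lambda>A. embed_L1 \<Omega> x A - embed_L1 \<Omega> xbar A) \<le> \<epsilon> \<longrightarrow>
            J (embed_L1 \<Omega> x) \<ge> J (embed_L1 \<Omega> xbar) + c / 2 * (L1_norm \<Omega> (\<lambda>w. x w - xbar w))^2)"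
    (is "?SSC \<longleftrightarrow> ?growth")
proof
  have \<Omega>: "open \<Omega>" "bounded \<Omega>" using assms(1) by (auto simp: bounded_lipschitz_domain_def)
  show ?growth if ?SSC
    using positive_curvature_imp_quadratic_growth[OF \<Omega> assms(2-6)] that by blast
  show ?SSC if growth: ?growth
  proof
    fix h assume h: "h \<in> critical_cone \<Omega> (embed_L1 \<Omega> xbar) \<phi> - {\<lambda>A. 0}"
    obtain c \<epsilon> where "c > 0" "\<epsilon> > 0" "\<forall>x \<in> Linf_ball \<Omega>.
            tv_norm \<Omega> (\<lambda>A. embed_L1 \<Omega> x A - embed_L1 \<Omega> xbar A) \<le> \<epsilon> \<longrightarrow>
            J (embed_L1 \<Omega> x) \<ge> J (embed_L1 \<Omega> xbar) + c / 2 * (L1_norm \<Omega> (\<lambda>w. x w - xbar w))^2"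
      using growth by blast
    then show "curvature \<Omega> (embed_L1 \<Omega> xbar) \<phi> h + ereal (J2 h h) > 0"
      using h by (intro quadratic_growth_imp_positive_curvature[OF \<Omega> assms(2-4), of c \<epsilon>]) auto
  qed
qed

end
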